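(* Let $\Gamma$ be the free group of rank $r$ with $2\le r<\infty$, let $\partial\Gamma$ be its boundary, and let $\mu$ be a quasi-invariant and doubly-ergodic measure on $\partial\Gamma$. If $$\varphi\colon C(\partial\Gamma)\to L^\infty(\partial\Gamma,\mu)$$ is a unital positive $\Gamma$-equivariant (linear) map, then $\varphi=\mathrm{id}$, i.e. for every $f\in C(\partial\Gamma)$, $\varphi(f)$ is the class of $f$ in $L^\infty(\partial\Gamma,\mu)$.
   Context: The boundary $\partial\Gamma$ of the free group $\Gamma$ (with respect to a fixed free generating set) is the compact space of all one-sided infinite reduced words in the generators and their inverses, with the (relative) product topology. $\Gamma$ acts on $\partial\Gamma$ by homeomorphisms by left translation (left multiplication followed by reduction). Measures on $\partial\Gamma$ are nonzero $\sigma$-finite Borel measures. A measure $\mu$ on $\partial\Gamma$ is quasi-invariant if for every measurable $X\subset\partial\Gamma$ and every $s\in\Gamma$, $\mu(sX)=0$ if and only if $\mu(X)=0$. It is doubly-ergodic if the diagonal action of $\Gamma$ on $(\partial\Gamma\times\partial\Gamma,\mu\otimes\mu)$ is ergodic, i.e. every $\Gamma$-invariant measurable subset is $\mu\otimes\mu$-null or $\mu\otimes\mu$-conull. $\Gamma$ acts on $C(\partial\Gamma)$ (complex-valued continuous functions) and on $L^\infty(\partial\Gamma,\mu)$ by $(s\cdot f)(\xi)=f(s^{-1}\xi)$. A map is $\Gamma$-equivariant if it commutes with the $\Gamma$-actions, i.e. $\varphi(s\cdot f)=s\cdot\varphi(f)$ for all $s\in\Gamma$ and all $f$. *)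

theory Defs
  imports "HOL-Analysis.Analysis" "HOL-Algebra.Group"
begin

section \<open>The free group on a type of generators\<close>

datatype 'a letter = Gen 'a | GenInv 'a

fun letter_inv :: "'a letter \<Rightarrow> 'a letter" where
  "letter_inv (Gen a) = GenInv a"
| "letter_inv (GenInv a) = Gen a"

definition reduced :: "'a letter list \<Rightarrow> bool" where
  "reduced w \<longleftrightarrow> successively (\<lambda>x y. y \<noteq> letter_inv x) w"

fun cons_letter :: "'a letter \<Rightarrow> 'a letter list \<Rightarrow> 'a letter list" where
  "cons_letter x [] = [x]"
| "cons_letter x (y # w) = (if y = letter_inv x then w else x # y # w)"

definition reduce :: "'a letter list \<Rightarrow> 'a letter list" where
  "reduce w = foldr cons_letter w []"

definition free_group :: "'a letter list monoid" where
  "free_group = \<lparr>carrier = {w. reduced w}, mult = (\<lambda>u v. reduce (u @ v)), one = []\<rparr>"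

lemma letter_inv_inv [simp]: "letter_inv (letter_inv x) = x"
  by (cases x) auto

lemma letter_inv_neq [simp]: "letter_inv x \<noteq> x" "x \<noteq> letter_inv x"
  by (cases x; simp)+

lemma reduced_Nil [simp]: "reduced []"
  by (simp add: reduced_def)

lemma reduced_tl: "reduced (x # w) \<Longrightarrow> reduced w"
  by (cases w) (auto simp: reduced_def)

lemma reduced_cons_letter: "reduced w \<Longrightarrow> reduced (cons_letter x w)"
  by (cases w rule: list.exhaust) (auto simp: reduced_def successively_Cons)

lemma cons_letter_cancel: "reduced w \<Longrightarrow> cons_letter x (cons_letter (letter_inv x) w) = w"
  by (cases w rule: remdups_adj.cases) (auto simp: reduced_def)

lemma reduced_foldr: "reduced w \<Longrightarrow> reduced (foldr cons_letter u w)"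
  by (induction u) (auto intro: reduced_cons_letter)

lemma reduced_reduce [simp]: "reduced (reduce w)"
  by (simp add: reduce_def reduced_foldr)

lemma reduce_reduced: "reduced w \<Longrightarrow> reduce w = w"
proof (induction w)
  case (Cons x w)
  then have "reduce w = w" using reduced_tl by blast
  then show ?case using Cons.prems
    by (cases w) (auto simp: reduce_def reduced_def)
qed (simp add: reduce_def)

lemma foldr_reduce:
  assumes cancel: "\<And>x z. P z \<Longrightarrow> g x (g (letter_inv x) z) = z"
    and inv: "\<And>x z. P z \<Longrightarrow> P (g x z)" and "P z"
  shows "foldr g (reduce u) z = foldr g u z"
proof (induction u)
  case (Cons x u)
  have P: "P (foldr g v z)" for v
    by (induction v) (use assms in auto)
  have "foldr g (cons_letter x v) z = g x (foldr g v z)" for v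
    by (cases v) (use cancel[OF P] in auto)
  then show ?case using Cons by (simp add: reduce_def)
qed (simp add: reduce_def)

lemma reduce_append_left: "reduce (reduce u @ v) = reduce (u @ v)"
  using foldr_reduce[of reduced cons_letter "reduce v" u]
  by (simp add: cons_letter_cancel reduced_cons_letter) (simp add: reduce_def)

lemma reduce_append_right: "reduce (u @ reduce v) = reduce (u @ v)"
  using reduce_reduced[OF reduced_reduce, of v] by (simp add: reduce_def)

lemma reduce_inverse: "reduce (rev (map letter_inv w) @ w) = []"
proof (induction w)
  case (Cons x w)
  have "reduce (rev (map letter_inv (x # w)) @ x # w)
      = foldr cons_letter (rev (map letter_inv w)) (cons_letter (letter_inv x) (cons_letter x (reduce w)))"
    by (simp add: reduce_def)
  also have "cons_letter (letter_inv x) (cons_letter x (reduce w)) = reduce w"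
    using cons_letter_cancel[OF reduced_reduce, of "letter_inv x"] by simp
  finally show ?case using Cons by (simp add: reduce_def)
qed (simp add: reduce_def)

lemma group_free_group: "group free_group"
proof (rule groupI)
  fix w :: "'a letter list" assume "w \<in> carrier free_group"
  have "reduce (reduce (rev (map letter_inv w)) @ w) = []"
    by (simp add: reduce_append_left reduce_inverse)
  then show "\<exists>v\<in>carrier free_group. v \<otimes>\<^bsub>free_group\<^esub> w = \<one>\<^bsub>free_group\<^esub>"
    by (intro bexI[of _ "reduce (rev (map letter_inv w))"]) (simp_all add: free_group_def)
qed (auto simp: free_group_def reduce_reduced reduce_append_left reduce_append_right)


section \<open>The boundary and the action by left translation\<close>

typedef 'a boundary = "{\<xi> :: nat \<Rightarrow> 'a letter. \<forall>n. \<xi> (Suc n) \<noteq> letter_inv (\<xi> n)}"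
  by (rule exI[of _ "\<lambda>_. Gen undefined"]) simp

instantiation boundary :: (type) topological_space
begin

definition open_boundary :: "'a boundary set \<Rightarrow> bool" where
  "open_boundary =
     openin (pullback_topology UNIV Rep_boundary (product_topology (\<lambda>_. discrete_topology UNIV) UNIV))"

instance
proof
  show "open (UNIV :: 'a boundary set)"
    unfolding open_boundary_def openin_pullback_topology
    using openin_topspace[of "product_topology (\<lambda>_::nat. discrete_topology (UNIV :: 'a letter set)) UNIV"]
    by (intro exI[of _ UNIV]) simp
qed (auto simp: open_boundary_def)

end

definition cons_boundary :: "'a letter \<Rightarrow> 'a boundary \<Rightarrow> 'a boundary" where
  "cons_boundary x \<xi> = Abs_boundary
     (if Rep_boundary \<xi> 0 = letter_inv x then (\<lambda>n. Rep_boundary \<xi> (Suc n))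
      else case_nat x (Rep_boundary \<xi>))"

definition act :: "'a letter list \<Rightarrow> 'a boundary \<Rightarrow> 'a boundary" where
  "act s \<xi> = foldr cons_boundary s \<xi>"

lemma Rep_boundary_Suc: "Rep_boundary \<xi> (Suc n) \<noteq> letter_inv (Rep_boundary \<xi> n)"
  using Rep_boundary[of \<xi>] by simp

lemma Rep_cons_boundary:
  "Rep_boundary (cons_boundary x \<xi>) =
     (if Rep_boundary \<xi> 0 = letter_inv x then (\<lambda>n. Rep_boundary \<xi> (Suc n))
      else case_nat x (Rep_boundary \<xi>))"
  unfolding cons_boundary_def
  by (rule Abs_boundary_inverse) (auto simp: Rep_boundary_Suc split: nat.split)

lemma cons_boundary_cancel: "cons_boundary x (cons_boundary (letter_inv x) \<xi>) = \<xi>"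
  using Rep_boundary_Suc[of \<xi> 0]
  by (auto simp: Rep_boundary_inject[symmetric] Rep_cons_boundary fun_eq_iff split: nat.split)

lemma act_reduce: "act (reduce s) \<xi> = act s \<xi>"
  unfolding act_def by (rule foldr_reduce[where P = "\<lambda>_. True"]) (auto simp: cons_boundary_cancel)

lemma act_one: "act \<one>\<^bsub>free_group\<^esub> \<xi> = \<xi>"
  by (simp add: act_def free_group_def)

lemma act_mult: "act (s \<otimes>\<^bsub>free_group\<^esub> t) \<xi> = act s (act t \<xi>)"
  by (simp add: free_group_def act_reduce) (simp add: act_def)

lemma act_inv:
  assumes "s \<in> carrier free_group"
  shows "act s (act (inv\<^bsub>free_group\<^esub> s) \<xi>) = \<xi>" "act (inv\<^bsub>free_group\<^esub> s) (act s \<xi>) = \<xi>"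
  using group.r_inv[OF group_free_group assms] group.l_inv[OF group_free_group assms]
  by (simp_all flip: act_mult add: act_one)

lemma open_letter: "open {\<xi>. Rep_boundary \<xi> n = a}"
proof -
  have "openin (product_topology (\<lambda>_. discrete_topology UNIV) UNIV) {\<xi> :: nat \<Rightarrow> 'a letter. \<xi> n = a}"
    using openin_continuous_map_preimage[OF continuous_map_product_projection[of n UNIV "\<lambda>_. discrete_topology UNIV"], of "{a}"]
    by simp
  then show ?thesis
    unfolding open_boundary_def openin_pullback_topology
    by (intro exI[of _ "{\<xi>. \<xi> n = a}"]) auto
qed

lemma continuous_on_boundaryI:
  fixes g :: "'b::topological_space \<Rightarrow> 'a boundary"
  assumes "\<And>n a. open {x. Rep_boundary (g x) n = a}"
  shows "continuous_on UNIV g"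
proof -
  have "open {x. Rep_boundary (g x) n \<in> U}" for n U
  proof -
    have "{x. Rep_boundary (g x) n \<in> U} = (\<Union>a\<in>U. {x. Rep_boundary (g x) n = a})" by auto
    then show ?thesis using assms by auto
  qed
  then have "continuous_map euclidean (product_topology (\<lambda>_. discrete_topology UNIV) UNIV) (Rep_boundary \<circ> g)"
    unfolding continuous_map_componentwise_UNIV by (simp add: continuous_map_def)
  then have *: "continuous_map euclidean
      (pullback_topology UNIV Rep_boundary (product_topology (\<lambda>_. discrete_topology UNIV) UNIV)) g"
    by (rule continuous_map_pullback') simp
  show ?thesis
    unfolding continuous_on_open_vimage[OF open_UNIV]
  proof (intro allI impI)
    fix B :: "'a boundary set" assume "open B"
    then have "openin euclidean {x \<in> topspace euclidean. g x \<in> B}"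
      using openin_continuous_map_preimage[OF *, of B] by (simp only: open_boundary_def)
    then show "open (g -` B \<inter> UNIV)" by (simp add: vimage_def)
  qed
qed

lemma continuous_cons_boundary: "continuous_on UNIV (cons_boundary x)"
proof (rule continuous_on_boundaryI)
  fix n and a :: "'a letter"
  define A where "A = {\<xi>. Rep_boundary \<xi> 0 = letter_inv x}"
  define B where "B = (\<Union>y\<in>-{letter_inv x}. {\<xi>. Rep_boundary \<xi> 0 = y})"
  define D where "D = {\<xi>. Rep_boundary \<xi> (Suc n) = a}"
  define E where "E = {\<xi>. (case n of 0 \<Rightarrow> x | Suc m \<Rightarrow> Rep_boundary \<xi> m) = a}"
  have B: "B = - A" by (auto simp: A_def B_def)
  have "{\<xi>. Rep_boundary (cons_boundary x \<xi>) n = a} = (A \<inter> D) \<union> (B \<inter> E)"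
    unfolding B by (rule Set.set_eqI) (simp add: A_def D_def E_def Rep_cons_boundary)
  moreover have "open A" "open D"
    by (simp_all add: A_def D_def open_letter)
  moreover have "open B"
    unfolding B_def by (rule open_UN) (simp add: open_letter)
  moreover have "open E"
    by (cases n) (simp_all add: E_def open_letter)
  ultimately show "open {\<xi>. Rep_boundary (cons_boundary x \<xi>) n = a}"
    by (simp add: open_Un open_Int)
qed

lemma continuous_act: "continuous_on UNIV (act s)"
proof (induction s)
  case (Cons x s)
  have "act (x # s) = cons_boundary x \<circ> act s" by (auto simp: act_def)
  then show ?case
    using continuous_on_compose[OF Cons continuous_on_subset[OF continuous_cons_boundary subset_UNIV]]
    by simp
qed (simp add: act_def)


section \<open>Measures on the boundary\<close>

definition boundary_measure :: "'a boundary measure \<Rightarrow> bool" where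
  "boundary_measure \<mu> \<longleftrightarrow>
     sets \<mu> = sets borel \<and> sigma_finite_measure \<mu> \<and> emeasure \<mu> (space \<mu>) \<noteq> 0"

definition quasi_invariant :: "'a boundary measure \<Rightarrow> bool" where
  "quasi_invariant \<mu> \<longleftrightarrow>
     (\<forall>X\<in>sets \<mu>. \<forall>s\<in>carrier free_group. emeasure \<mu> (act s ` X) = 0 \<longleftrightarrow> emeasure \<mu> X = 0)"

definition doubly_ergodic :: "'a boundary measure \<Rightarrow> bool" where
  "doubly_ergodic \<mu> \<longleftrightarrow>
     (\<forall>E\<in>sets (\<mu> \<Otimes>\<^sub>M \<mu>).
        (\<forall>s\<in>carrier free_group. map_prod (act s) (act s) ` E = E) \<longrightarrow>
        E \<in> null_sets (\<mu> \<Otimes>\<^sub>M \<mu>) \<or> space (\<mu> \<Otimes>\<^sub>M \<mu>) - E \<in> null_sets (\<mu> \<Otimes>\<^sub>M \<mu>))"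


section \<open>Essentially bounded functions modulo null sets\<close>

definition Linf_fun :: "'b measure \<Rightarrow> ('b \<Rightarrow> complex) set" where
  "Linf_fun M = {f \<in> borel_measurable M. \<exists>C. AE x in M. norm (f x) \<le> C}"

definition Linf_rel :: "'b measure \<Rightarrow> (('b \<Rightarrow> complex) \<times> ('b \<Rightarrow> complex)) set" where
  "Linf_rel M = {(f, g). f \<in> Linf_fun M \<and> g \<in> Linf_fun M \<and> (AE x in M. f x = g x)}"

definition Linf :: "'b measure \<Rightarrow> ('b \<Rightarrow> complex) set set" where
  "Linf M = Linf_fun M // Linf_rel M"

definition Linf_class :: "'b measure \<Rightarrow> ('b \<Rightarrow> complex) \<Rightarrow> ('b \<Rightarrow> complex) set" where
  "Linf_class M f = Linf_rel M `` {f}"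

text \<open>
  The operations on classes are induced by those on representatives; the union over all
  representatives is a single class whenever the operation respects almost everywhere equality.
\<close>

definition Linf_add ::
  "'b measure \<Rightarrow> ('b \<Rightarrow> complex) set \<Rightarrow> ('b \<Rightarrow> complex) set \<Rightarrow> ('b \<Rightarrow> complex) set" where
  "Linf_add M F G = (\<Union>f\<in>F. \<Union>g\<in>G. Linf_class M (\<lambda>x. f x + g x))"

definition Linf_scale ::
  "'b measure \<Rightarrow> complex \<Rightarrow> ('b \<Rightarrow> complex) set \<Rightarrow> ('b \<Rightarrow> complex) set" where
  "Linf_scale M c F = (\<Union>f\<in>F. Linf_class M (\<lambda>x. c * f x))"

definition Linf_nonneg :: "'b measure \<Rightarrow> ('b \<Rightarrow> complex) set \<Rightarrow> bool" where
  "Linf_nonneg M F \<longleftrightarrow> (\<forall>f\<in>F. AE x in M. f x \<in> \<real>\<^sub>\<ge>\<^sub>0)"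

definition translate ::
  "'a letter list \<Rightarrow> ('a boundary \<Rightarrow> complex) \<Rightarrow> ('a boundary \<Rightarrow> complex)" where
  "translate s f = (\<lambda>\<xi>. f (act (inv\<^bsub>free_group\<^esub> s) \<xi>))"

definition Linf_translate ::
  "'a boundary measure \<Rightarrow> 'a letter list \<Rightarrow> ('a boundary \<Rightarrow> complex) set \<Rightarrow> ('a boundary \<Rightarrow> complex) set"
  where "Linf_translate \<mu> s F = (\<Union>f\<in>F. Linf_class \<mu> (translate s f))"

lemma equiv_Linf_rel: "equiv (Linf_fun M) (Linf_rel M)"
  by (rule equivI) (auto simp: Linf_rel_def refl_on_def sym_on_def trans_on_def)

lemma Linf_class_in: "f \<in> Linf_fun M \<Longrightarrow> Linf_class M f \<in> Linf M"
  by (simp add: Linf_def Linf_class_def quotientI)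

lemma Linf_class_eq_iff:
  "f \<in> Linf_fun M \<Longrightarrow> g \<in> Linf_fun M \<Longrightarrow> Linf_class M f = Linf_class M g \<longleftrightarrow> (AE x in M. f x = g x)"
  unfolding Linf_class_def
  by (subst eq_equiv_class_iff[OF equiv_Linf_rel]) (auto simp: Linf_rel_def)

lemma Linf_nonneg_class:
  assumes "f \<in> Linf_fun M"
  shows "Linf_nonneg M (Linf_class M f) \<longleftrightarrow> (AE x in M. f x \<in> \<real>\<^sub>\<ge>\<^sub>0)"
proof
  assume "Linf_nonneg M (Linf_class M f)"
  then show "AE x in M. f x \<in> \<real>\<^sub>\<ge>\<^sub>0"
    using assms by (auto simp: Linf_nonneg_def Linf_class_def Linf_rel_def)
next
  assume *: "AE x in M. f x \<in> \<real>\<^sub>\<ge>\<^sub>0"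
  show "Linf_nonneg M (Linf_class M f)"
    unfolding Linf_nonneg_def
  proof
    fix g assume "g \<in> Linf_class M f"
    then have "AE x in M. f x = g x" by (simp add: Linf_class_def Linf_rel_def)
    with * show "AE x in M. g x \<in> \<real>\<^sub>\<ge>\<^sub>0" by eventually_elim simp
  qed
qed

lemma Linf_fun_add:
  assumes "f \<in> Linf_fun M" "g \<in> Linf_fun M"
  shows "(\<lambda>x. f x + g x) \<in> Linf_fun M"
proof -
  obtain A B where "AE x in M. norm (f x) \<le> A" "AE x in M. norm (g x) \<le> B"
    using assms by (auto simp: Linf_fun_def)
  then have "AE x in M. norm (f x + g x) \<le> A + B"
    by eventually_elim (rule norm_triangle_mono)
  then show ?thesis using assms by (auto simp: Linf_fun_def)
qed

lemma Linf_fun_scale: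
  assumes "f \<in> Linf_fun M"
  shows "(\<lambda>x. c * f x) \<in> Linf_fun M"
proof -
  obtain A where "AE x in M. norm (f x) \<le> A"
    using assms by (auto simp: Linf_fun_def)
  then have "AE x in M. norm (c * f x) \<le> norm c * A"
    by eventually_elim (simp add: norm_mult mult_left_mono)
  then show ?thesis using assms by (auto simp: Linf_fun_def)
qed

lemma Linf_add_class:
  assumes "f \<in> Linf_fun M" "g \<in> Linf_fun M"
  shows "Linf_add M (Linf_class M f) (Linf_class M g) = Linf_class M (\<lambda>x. f x + g x)"
proof -
  have "Linf_class M (\<lambda>x. f' x + g' x) = Linf_class M (\<lambda>x. f x + g x)"
    if "f' \<in> Linf_class M f" "g' \<in> Linf_class M g" for f' g'
  proof (subst Linf_class_eq_iff)
    have "AE x in M. f x = f' x" "AE x in M. g x = g' x"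
      using that by (auto simp: Linf_class_def Linf_rel_def)
    then show "AE x in M. f' x + g' x = f x + g x" by eventually_elim simp
  qed (use that assms in \<open>auto simp: Linf_class_def Linf_rel_def intro: Linf_fun_add\<close>)
  moreover have "f \<in> Linf_class M f" "g \<in> Linf_class M g"
    using assms by (auto simp: Linf_class_def Linf_rel_def)
  ultimately show ?thesis unfolding Linf_add_def by blast
qed

lemma Linf_scale_class:
  assumes "f \<in> Linf_fun M"
  shows "Linf_scale M c (Linf_class M f) = Linf_class M (\<lambda>x. c * f x)"
proof -
  have "Linf_class M (\<lambda>x. c * f' x) = Linf_class M (\<lambda>x. c * f x)"
    if "f' \<in> Linf_class M f" for f'
  proof (subst Linf_class_eq_iff)
    have "AE x in M. f x = f' x"
      using that by (auto simp: Linf_class_def Linf_rel_def)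
    then show "AE x in M. c * f' x = c * f x" by eventually_elim simp
  qed (use that assms in \<open>auto simp: Linf_class_def Linf_rel_def intro: Linf_fun_scale\<close>)
  moreover have "f \<in> Linf_class M f"
    using assms by (auto simp: Linf_class_def Linf_rel_def)
  ultimately show ?thesis unfolding Linf_scale_def by blast
qed

lemma AE_act_inv:
  assumes "boundary_measure \<mu>" "quasi_invariant \<mu>" "s \<in> carrier free_group" "AE \<xi> in \<mu>. P \<xi>"
  shows "AE \<xi> in \<mu>. P (act (inv\<^bsub>free_group\<^esub> s) \<xi>)"
proof -
  have sets: "sets \<mu> = sets borel" and space: "space \<mu> = UNIV"
    using assms(1) sets_eq_imp_space_eq[of \<mu> borel] by (auto simp: boundary_measure_def)
  obtain N where N: "N \<in> sets \<mu>" "emeasure \<mu> N = 0" "{\<xi>. \<not> P \<xi>} \<subseteq> N"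
    using assms(4) unfolding space eventually_ae_filter null_sets_def by (auto simp: space)
  have image: "act s ` N = act (inv\<^bsub>free_group\<^esub> s) -` N"
  proof (rule Set.set_eqI, rule iffI)
    fix \<xi> assume "\<xi> \<in> act (inv\<^bsub>free_group\<^esub> s) -` N"
    then show "\<xi> \<in> act s ` N"
      using act_inv(1)[OF assms(3), of \<xi>] by (intro image_eqI[of \<xi> "act s"]) simp_all
  qed (auto simp: act_inv(2)[OF assms(3)])
  have "act (inv\<^bsub>free_group\<^esub> s) \<in> borel_measurable borel"
    by (rule borel_measurable_continuous_onI[OF continuous_act])
  then have "act s ` N \<in> sets \<mu>"
    using measurable_sets[of _ borel borel N] N(1) by (auto simp: image sets)
  moreover have "emeasure \<mu> (act s ` N) = 0"
    using assms(2,3) N by (auto simp: quasi_invariant_def)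
  ultimately have "act s ` N \<in> null_sets \<mu>" by auto
  then show ?thesis
    by (rule AE_I') (use N(3) image in auto)
qed

lemma Linf_fun_translate:
  assumes "boundary_measure \<mu>" "quasi_invariant \<mu>" "s \<in> carrier free_group" "f \<in> Linf_fun \<mu>"
  shows "translate s f \<in> Linf_fun \<mu>"
proof -
  have sets: "sets \<mu> = sets borel"
    using assms(1) by (auto simp: boundary_measure_def)
  have "act (inv\<^bsub>free_group\<^esub> s) \<in> measurable \<mu> \<mu>"
    using borel_measurable_continuous_onI[OF continuous_act]
    by (simp add: measurable_cong_sets[OF sets sets])
  moreover obtain C where "AE \<xi> in \<mu>. norm (f \<xi>) \<le> C"
    using assms(4) by (auto simp: Linf_fun_def)
  ultimately show ?thesis
    using AE_act_inv[OF assms(1-3)] assms(4)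
    by (fastforce simp: Linf_fun_def translate_def intro: measurable_compose)
qed

lemma Linf_translate_class:
  assumes "boundary_measure \<mu>" "quasi_invariant \<mu>" "s \<in> carrier free_group" "f \<in> Linf_fun \<mu>"
  shows "Linf_translate \<mu> s (Linf_class \<mu> f) = Linf_class \<mu> (translate s f)"
proof -
  have "Linf_class \<mu> (translate s f') = Linf_class \<mu> (translate s f)"
    if "f' \<in> Linf_class \<mu> f" for f'
  proof (subst Linf_class_eq_iff)
    have "AE \<xi> in \<mu>. f' \<xi> = f \<xi>"
      using that by (auto simp: Linf_class_def Linf_rel_def eq_commute)
    then show "AE \<xi> in \<mu>. translate s f' \<xi> = translate s f \<xi>"
      unfolding translate_def by (rule AE_act_inv[OF assms(1-3)])
  qed (use that assms in \<open>auto simp: Linf_class_def Linf_rel_def intro: Linf_fun_translate\<close>)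
  moreover have "f \<in> Linf_class \<mu> f"
    using assms by (auto simp: Linf_class_def Linf_rel_def)
  ultimately show ?thesis unfolding Linf_translate_def by blast
qed


section \<open>Maps from continuous functions to essentially bounded functions\<close>

definition C_boundary :: "('a boundary \<Rightarrow> complex) set" where
  "C_boundary = {f. continuous_on UNIV f}"

definition linear_map ::
  "'a boundary measure \<Rightarrow> (('a boundary \<Rightarrow> complex) \<Rightarrow> ('a boundary \<Rightarrow> complex) set) \<Rightarrow> bool" where
  "linear_map \<mu> \<phi> \<longleftrightarrow>
     (\<forall>f\<in>C_boundary. \<forall>g\<in>C_boundary. \<phi> (\<lambda>\<xi>. f \<xi> + g \<xi>) = Linf_add \<mu> (\<phi> f) (\<phi> g)) \<and>
     (\<forall>c. \<forall>f\<in>C_boundary. \<phi> (\<lambda>\<xi>. c * f \<xi>) = Linf_scale \<mu> c (\<phi> f))"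

definition unital_map ::
  "'a boundary measure \<Rightarrow> (('a boundary \<Rightarrow> complex) \<Rightarrow> ('a boundary \<Rightarrow> complex) set) \<Rightarrow> bool" where
  "unital_map \<mu> \<phi> \<longleftrightarrow> \<phi> (\<lambda>_. 1) = Linf_class \<mu> (\<lambda>_. 1)"

definition positive_map ::
  "'a boundary measure \<Rightarrow> (('a boundary \<Rightarrow> complex) \<Rightarrow> ('a boundary \<Rightarrow> complex) set) \<Rightarrow> bool" where
  "positive_map \<mu> \<phi> \<longleftrightarrow> (\<forall>f\<in>C_boundary. (\<forall>\<xi>. f \<xi> \<in> \<real>\<^sub>\<ge>\<^sub>0) \<longrightarrow> Linf_nonneg \<mu> (\<phi> f))"

definition equivariant_map ::
  "'a boundary measure \<Rightarrow> (('a boundary \<Rightarrow> complex) \<Rightarrow> ('a boundary \<Rightarrow> complex) set) \<Rightarrow> bool" where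
  "equivariant_map \<mu> \<phi> \<longleftrightarrow>
     (\<forall>s\<in>carrier free_group. \<forall>f\<in>C_boundary. \<phi> (translate s f) = Linf_translate \<mu> s (\<phi> f))"

end

theory Submission
  imports Defs
begin

text \<open>
  Disintegrating \<open>\<phi>\<close> gives a random probability measure \<open>\<nu>\<^sub>\<xi>\<close> on the boundary, equivariant in \<open>\<xi>\<close>,
  and the claim is that \<open>\<nu>\<^sub>\<xi>\<close> is the point mass at \<open>\<xi>\<close>. Think of the boundary as the ends of the Cayley
  tree. For \<open>\<xi> \<noteq> \<eta>\<close>, every end \<open>\<zeta>\<close> other than \<open>\<xi>\<close> and \<open>\<eta>\<close> projects to one vertex of the geodesic from \<open>\<xi>\<close> to
  \<open>\<eta>\<close>, namely the centre of the tripod spanned by \<open>\<xi>\<close>, \<open>\<eta>\<close> and \<open>\<zeta>\<close>. The identity is the centre exactly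
  when the first letters of the three ends are distinct, so uniqueness of the centre says that at
  most one group element \<open>s\<close> gives \<open>s\<xi>\<close>, \<open>s\<eta>\<close> and \<open>s\<zeta>\<close> distinct first letters (\<open>centre_unique\<close>).

  Let \<open>F (\<xi>, \<eta>)\<close> be the \<open>\<nu>\<^sub>\<xi>\<close>-mass of the ends that project to the identity. The values of \<open>F\<close> along
  the orbit of \<open>(\<xi>, \<eta>)\<close> are masses of disjoint sets, so their sum is at most \<open>1\<close>
  (\<open>mass_along_geodesic_le_1\<close>). Double ergodicity forces such a function to vanish
  (\<open>summable_on_orbits_imp_nonpos\<close>): if \<open>F > \<epsilon>\<close> on a set \<open>E\<close> of positive measure, cut \<open>E\<close> into \<open>n\<close>
  disjoint pieces of positive measure. By ergodicity almost every orbit meets every piece, and so the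
  sum over that orbit is at least \<open>n\<epsilon>\<close>, for every \<open>n\<close>. The cutting is possible because \<open>\<mu>\<close> has no
  atoms: the diagonal is an invariant set, and it is not conull as the cylinders of single letters
  all have positive measure.

  Hence \<open>F = 0\<close> almost everywhere. If \<open>x\<close> is not the first letter of \<open>\<xi>\<close>, all ends that begin with \<open>x\<close> project
  to the identity as soon as \<open>\<eta>\<close> begins with a third letter, and such \<open>\<eta>\<close> form a set of positive measure.
  So \<open>\<nu>\<^sub>\<xi>\<close> only charges ends with the same first letter as \<open>\<xi>\<close>. Equivariance extends this to longer
  prefixes, and locally constant functions are uniformly dense in the continuous ones.

  Only countably many cylinder sets enter this argument, so the disintegration itself is never formed:
  the \<open>\<nu>\<^sub>\<xi>\<close>-mass of a cylinder is read off from a representative of the image under \<open>\<phi>\<close> of its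
  indicator.
\<close>


section \<open>Centres of triples of ends\<close>

instance letter :: (finite) finite
proof
  have "(UNIV :: 'a letter set) = range Gen \<union> range GenInv"
    by (auto simp: image_iff) (metis letter.exhaust)
  then show "finite (UNIV :: 'a letter set)"
    by (metis finite finite_UnI finite_imageI)
qed

abbreviation first_letter :: "'a boundary \<Rightarrow> 'a letter" where
  "first_letter \<xi> \<equiv> Rep_boundary \<xi> 0"

text \<open>
  Under the assumption on \<open>\<zeta>\<close> nothing cancels between \<open>v\<close> and \<open>\<zeta>\<close>, and \<open>hd v\<close> survives in front.
\<close>

lemma first_letter_act:
  assumes "reduced v" "v \<noteq> []" "first_letter \<zeta> \<noteq> letter_inv (last v)"
  shows "first_letter (act v \<zeta>) = hd v"
  using assms
proof (induction v)
  case (Cons x v)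
  show ?case
  proof (cases v)
    case Nil
    then show ?thesis using Cons.prems by (simp add: act_def Rep_cons_boundary)
  next
    case (Cons y w)
    then have "first_letter (act v \<zeta>) = y"
      using Cons.IH Cons.prems reduced_tl by auto
    moreover have "y \<noteq> letter_inv x"
      using Cons.prems(1) Cons by (simp add: reduced_def)
    ultimately show ?thesis by (simp add: act_def Rep_cons_boundary)
  qed
qed simp

text \<open>
  Write \<open>t = vs\<close>. Of three ends with distinct first letters at least two avoid the only letter that can
  cancel against the last letter of \<open>v\<close>, so if \<open>v\<close> is not empty, \<open>v\<close> gives these two the same
  first letter.
\<close>

lemma centre_unique:
  assumes s: "s \<in> carrier free_group" and t: "t \<in> carrier free_group"
    and ds: "distinct [first_letter (act s \<xi>), first_letter (act s \<eta>), first_letter (act s \<zeta>)]"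
    and dt: "distinct [first_letter (act t \<xi>), first_letter (act t \<eta>), first_letter (act t \<zeta>)]"
  shows "s = t"
proof -
  interpret group "free_group :: 'a letter list monoid" by (rule group_free_group)
  define v where "v = t \<otimes>\<^bsub>free_group\<^esub> inv\<^bsub>free_group\<^esub> s"
  have v: "v \<in> carrier free_group" using s t by (simp add: v_def)
  have act_t: "act t \<omega> = act v (act s \<omega>)" for \<omega>
    using s by (simp add: v_def act_mult act_inv)
  have "v = []"
  proof (rule ccontr)
    assume "v \<noteq> []"
    moreover have "reduced v" using v by (simp add: free_group_def)
    ultimately have "first_letter (act t \<omega>) = hd v"
      if "first_letter (act s \<omega>) \<noteq> letter_inv (last v)" for \<omega>
      using first_letter_act that by (simp add: act_t)
    then show False using ds dt by (metis distinct_length_2_or_more)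
  qed
  then have "t \<otimes>\<^bsub>free_group\<^esub> inv\<^bsub>free_group\<^esub> s = \<one>\<^bsub>free_group\<^esub>"
    by (simp add: v_def[symmetric]) (simp add: free_group_def)
  then show ?thesis using s t by (metis inv_closed inv_equality inv_inv)
qed

lemma exists_third_letter:
  assumes "2 \<le> CARD('a::finite)"
  shows "\<exists>z :: 'a letter. z \<noteq> x \<and> z \<noteq> y"
proof -
  obtain a b :: 'a where "a \<noteq> b"
    using assms card_le_Suc0_iff_eq[OF finite[of "UNIV :: 'a set"]] by auto
  then show ?thesis
    by (metis letter.distinct(1) letter.inject(1))
qed

section \<open>Prefixes and uniform continuity\<close>

definition boundary_prefix :: "nat \<Rightarrow> 'a boundary \<Rightarrow> 'a letter list" where
  "boundary_prefix n \<xi> = map (Rep_boundary \<xi>) [0..<n]"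

lemma generator_in_free_group [simp]: "[x] \<in> carrier free_group"
  by (simp add: free_group_def reduced_def)

lemma act_inv_generator: "act (inv\<^bsub>free_group\<^esub> [x]) \<xi> = cons_boundary (letter_inv x) \<xi>"
proof -
  have "act [x] (cons_boundary (letter_inv x) \<xi>) = \<xi>"
    by (simp add: act_def cons_boundary_cancel)
  then show ?thesis
    using act_inv(2)[OF generator_in_free_group, of x "cons_boundary (letter_inv x) \<xi>"] by simp
qed

text \<open>
  If \<open>\<xi>\<close> begins with \<open>x\<close>, multiplication by the inverse of \<open>x\<close> deletes that letter. Otherwise it puts
  the inverse of \<open>x\<close> in front, which is not \<open>y\<close>, and both sides are false.
\<close>

lemma boundary_prefix_Suc_Suc_eq:
  assumes "y \<noteq> letter_inv x"
  shows "boundary_prefix (Suc (Suc n)) \<xi> = x # y # w \<longleftrightarrow>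
    boundary_prefix (Suc n) (cons_boundary (letter_inv x) \<xi>) = y # w"
proof -
  have shift: "map g [0..<Suc m] = g 0 # map (\<lambda>i. g (Suc i)) [0..<m]" for g :: "nat \<Rightarrow> 'a letter" and m
    by (simp only: map_upt_Suc)
  show ?thesis
    using assms unfolding boundary_prefix_def shift[of "Rep_boundary \<xi>" "Suc n"]
    by (cases "first_letter \<xi> = x") (simp_all add: Rep_cons_boundary shift del: upt_Suc)
qed

lemma open_boundary_iff:
  "open (U :: 'a boundary set) \<longleftrightarrow>
    (\<exists>V. openin (product_topology (\<lambda>_. discrete_topology UNIV) UNIV) V \<and> U = Rep_boundary -` V)"
  unfolding open_boundary_def openin_pullback_topology by auto

lemma open_contains_prefix_cylinder:
  assumes "open U" "\<xi> \<in> U"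
  shows "\<exists>n. \<forall>\<zeta>. boundary_prefix n \<zeta> = boundary_prefix n \<xi> \<longrightarrow> \<zeta> \<in> U"
proof -
  obtain V where V: "openin (product_topology (\<lambda>_::nat. discrete_topology UNIV) UNIV) V"
    "U = Rep_boundary -` V"
    using assms(1) open_boundary_iff by blast
  then have "Rep_boundary \<xi> \<in> V" using assms by simp
  then obtain W where W: "finite {i. W i \<noteq> UNIV}" "Rep_boundary \<xi> \<in> Pi\<^sub>E UNIV W" "Pi\<^sub>E UNIV W \<subseteq> V"
    using V(1) unfolding openin_product_topology_alt by auto
  obtain n where n: "\<And>i. W i \<noteq> UNIV \<Longrightarrow> i < n"
    using finite_nat_set_iff_bounded[THEN iffD1, OF W(1)] by auto
  have "\<zeta> \<in> U" if "boundary_prefix n \<zeta> = boundary_prefix n \<xi>" for \<zeta>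
  proof -
    have "Rep_boundary \<zeta> i = Rep_boundary \<xi> i" if "i < n" for i
      using \<open>boundary_prefix n \<zeta> = boundary_prefix n \<xi>\<close> that by (simp add: boundary_prefix_def)
    then have "Rep_boundary \<zeta> i \<in> W i" for i
      using W(2) n[of i] by (cases "W i = UNIV") (auto simp: PiE_iff)
    then show ?thesis using W(3) V(2) by (auto simp: PiE_iff)
  qed
  then show ?thesis by blast
qed

text \<open>
  The conditions that cut the reduced words out of the compact product of the finite alphabets are
  closed.
\<close>

lemma compact_boundary: "compact (UNIV :: 'a::finite boundary set)"
proof -
  define X where "X = product_topology (\<lambda>_::nat. discrete_topology (UNIV :: 'a letter set)) UNIV"
  have X_compact: "compact_space X"
    unfolding X_def compact_space_product_topology
    by (simp add: compact_space_discrete_topology)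
  have "closedin X (range Rep_boundary)"
  proof -
    have proj: "continuous_map X (discrete_topology UNIV) (\<lambda>f. f n)" for n
      unfolding X_def by (rule continuous_map_product_projection) simp
    have "openin X {f. f n = a}" for n a
      using openin_continuous_map_preimage[OF proj[of n], of "{a}"] by (simp add: X_def)
    then have op: "openin X ({f. f (Suc n) = letter_inv a} \<inter> {f. f n = a})" for n a
      by blast
    have "UNIV - range (Rep_boundary :: 'a boundary \<Rightarrow> _) = (\<Union>n. \<Union>a. {f. f (Suc n) = letter_inv a} \<inter> {f. f n = a})"
    proof (rule Set.set_eqI)
      fix f :: "nat \<Rightarrow> 'a letter"
      have "f \<in> range Rep_boundary \<longleftrightarrow> (\<forall>n. f (Suc n) \<noteq> letter_inv (f n))"
        using type_definition.Rep_range[OF type_definition_boundary] by auto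
      then show "f \<in> UNIV - range Rep_boundary \<longleftrightarrow>
        f \<in> (\<Union>n. \<Union>a. {f. f (Suc n) = letter_inv a} \<inter> {f. f n = a})" by simp
    qed
    moreover have "openin X (\<Union>n. \<Union>a. {f. f (Suc n) = letter_inv a} \<inter> {f. f n = a})"
      using op by (intro openin_Union) auto
    ultimately show ?thesis by (simp add: closedin_def X_def)
  qed
  then have range_compact: "compactin X (range Rep_boundary)"
    using X_compact closedin_compact_space by blast
  show ?thesis
    unfolding compact_eq_Heine_Borel
  proof (intro allI impI)
    fix \<C> :: "'a boundary set set"
    assume \<C>: "(\<forall>U\<in>\<C>. open U) \<and> UNIV \<subseteq> \<Union>\<C>"
    define \<V> where "\<V> = {V. openin X V \<and> Rep_boundary -` V \<in> \<C>}"
    have "range Rep_boundary \<subseteq> \<Union>\<V>"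
    proof
      fix f :: "nat \<Rightarrow> 'a letter" assume "f \<in> range Rep_boundary"
      then obtain \<xi> where f: "f = Rep_boundary \<xi>" by auto
      obtain U where "U \<in> \<C>" "\<xi> \<in> U" using \<C> by auto
      then show "f \<in> \<Union>\<V>"
        using \<C> open_boundary_iff[of U] unfolding \<V>_def X_def f by auto
    qed
    moreover have "\<forall>V\<in>\<V>. openin X V" by (simp add: \<V>_def)
    ultimately obtain \<F> where "finite \<F>" "\<F> \<subseteq> \<V>" "range Rep_boundary \<subseteq> \<Union>\<F>"
      using range_compact unfolding compactin_def by metis
    then show "\<exists>\<C>'\<subseteq>\<C>. finite \<C>' \<and> UNIV \<subseteq> \<Union>\<C>'"
      by (intro exI[of _ "(\<lambda>V. Rep_boundary -` V) ` \<F>"]) (auto simp: \<V>_def, metis UnionE rangeI subsetD)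
  qed
qed

lemma continuous_uniform_on_prefixes:
  fixes f :: "'a::finite boundary \<Rightarrow> 'b::metric_space"
  assumes "continuous_on UNIV f" "0 < e"
  shows "\<exists>n. \<forall>\<xi> \<zeta>. boundary_prefix n \<xi> = boundary_prefix n \<zeta> \<longrightarrow> dist (f \<xi>) (f \<zeta>) < e"
proof -
  have mono: "boundary_prefix m \<xi> = boundary_prefix m \<zeta>"
    if "boundary_prefix n \<xi> = boundary_prefix n \<zeta>" "m \<le> n" for m n and \<xi> \<zeta> :: "'a boundary"
    using that by (simp add: boundary_prefix_def)
  have "\<exists>n. \<forall>\<zeta>. boundary_prefix n \<zeta> = boundary_prefix n \<xi> \<longrightarrow> \<zeta> \<in> f -` ball (f \<xi>) (e/2)" for \<xi>
    using assms by (intro open_contains_prefix_cylinder open_vimage) auto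
  then obtain N where N: "\<And>\<xi> \<zeta>. boundary_prefix (N \<xi>) \<zeta> = boundary_prefix (N \<xi>) \<xi> \<Longrightarrow>
    dist (f \<xi>) (f \<zeta>) < e/2"
    by (auto simp: choice_iff) metis
  define U where "U \<xi> = {\<zeta>. boundary_prefix (N \<xi>) \<zeta> = boundary_prefix (N \<xi>) \<xi>}" for \<xi>
  have "U \<xi> = (\<Inter>i\<in>{..<N \<xi>}. {\<zeta>. Rep_boundary \<zeta> i = Rep_boundary \<xi> i})" for \<xi>
    by (auto simp: U_def boundary_prefix_def)
  then have "open (U \<xi>)" for \<xi>
    by (simp add: open_INT open_letter)
  moreover have "\<xi> \<in> U \<xi>" for \<xi> by (simp add: U_def)
  moreover have "UNIV \<subseteq> (\<Union>\<xi>. U \<xi>)" using calculation(2) by auto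
  ultimately obtain D where D: "finite D" "UNIV \<subseteq> (\<Union>\<xi>\<in>D. U \<xi>)"
    using compactE_image[OF compact_boundary, of UNIV U] by metis
  have "dist (f \<xi>) (f \<zeta>) < e"
    if eq: "boundary_prefix (Max (insert 0 (N ` D))) \<xi> = boundary_prefix (Max (insert 0 (N ` D))) \<zeta>" for \<xi> \<zeta>
  proof -
    obtain \<omega> where \<omega>: "\<omega> \<in> D" "\<xi> \<in> U \<omega>" using D(2) by auto
    have "N \<omega> \<le> Max (insert 0 (N ` D))" using D(1) \<omega>(1) by simp
    then have "boundary_prefix (N \<omega>) \<zeta> = boundary_prefix (N \<omega>) \<xi>" using mono[OF eq] by simp
    then have "dist (f \<omega>) (f \<xi>) < e/2" "dist (f \<omega>) (f \<zeta>) < e/2"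
      using N \<omega>(2) by (auto simp: U_def)
    then show ?thesis using dist_triangle_half_r by blast
  qed
  then show ?thesis by blast
qed

section \<open>Doubly ergodic measures\<close>

locale doubly_ergodic_boundary =
  fixes \<mu> :: "'a::finite boundary measure"
  assumes two_generators: "2 \<le> CARD('a)"
    and measure: "boundary_measure \<mu>"
    and quasi_inv: "quasi_invariant \<mu>"
    and double_erg: "doubly_ergodic \<mu>"
begin

lemma sets_\<mu>: "sets \<mu> = sets borel"
  using measure by (simp add: boundary_measure_def)

lemma space_\<mu> [simp]: "space \<mu> = UNIV"
  using sets_eq_imp_space_eq[OF sets_\<mu>] by simp

sublocale sigma_finite_measure \<mu>
  using measure by (simp add: boundary_measure_def)

sublocale pair: pair_sigma_finite \<mu> \<mu> ..

lemma not_AE_False: "\<not> (AE \<xi> in \<mu>. False)"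
  using measure AE_iff_null[of \<mu> "\<lambda>_. False"] by (auto simp: boundary_measure_def null_sets_def)

lemma AE_act:
  assumes "s \<in> carrier free_group" "AE \<xi> in \<mu>. P \<xi>"
  shows "AE \<xi> in \<mu>. P (act s \<xi>)"
proof -
  interpret group "free_group :: 'a letter list monoid" by (rule group_free_group)
  show ?thesis
    using AE_act_inv[OF measure quasi_inv inv_closed[OF assms(1)] assms(2)] assms(1) by simp
qed

lemma coordinate_set: "{\<xi>. Rep_boundary \<xi> n = a} \<in> sets \<mu>"
  by (simp add: sets_\<mu> open_letter)

lemma measurable_coordinate [measurable]:
  "(\<lambda>\<xi>. Rep_boundary \<xi> n) \<in> measurable \<mu> (count_space UNIV)"
  using coordinate_set by (simp add: measurable_count_space_eq2 vimage_def)

lemma measurable_act [measurable]: "act s \<in> measurable \<mu> \<mu>"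
  using borel_measurable_continuous_onI[OF continuous_act]
  by (simp add: measurable_cong_sets[OF sets_\<mu> sets_\<mu>])

text \<open>
  Suppose that almost no \<open>\<xi>\<close> begins with \<open>y\<close>. By quasi-invariance the same holds for \<open>y\<xi>\<close>, which means
  that almost every \<open>\<xi>\<close> begins with the inverse of \<open>y\<close>. By quasi-invariance again this holds for \<open>z\<xi>\<close>,
  where \<open>z\<close> is a third letter; but for such \<open>\<xi>\<close> nothing cancels, and \<open>z\<xi>\<close> begins with \<open>z\<close>.
\<close>

lemma first_letter_cylinder_positive: "emeasure \<mu> {\<xi>. first_letter \<xi> = y} \<noteq> 0"
proof
  assume "emeasure \<mu> {\<xi>. first_letter \<xi> = y} = 0"
  then have "AE \<xi> in \<mu>. first_letter \<xi> \<noteq> y"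
    using coordinate_set[of 0 y] by (intro AE_I'[of "{\<xi>. first_letter \<xi> = y}"]) auto
  then have "AE \<xi> in \<mu>. first_letter (act [y] \<xi>) \<noteq> y"
    by (rule AE_act[rotated]) simp
  then have inv_y: "AE \<xi> in \<mu>. first_letter \<xi> = letter_inv y"
    by eventually_elim (auto simp: act_def Rep_cons_boundary split: if_splits)
  obtain z where z: "z \<noteq> y" "z \<noteq> letter_inv y"
    using exists_third_letter[OF two_generators] by blast
  have "AE \<xi> in \<mu>. first_letter (act [z] \<xi>) = letter_inv y"
    using inv_y by (rule AE_act[rotated]) simp
  with inv_y have "AE \<xi> in \<mu>. False"
  proof eventually_elim
    case (elim \<xi>)
    have "letter_inv y \<noteq> letter_inv z" using z(1) letter_inv_inv by metis
    then have "first_letter (act [z] \<xi>) = z" using elim by (simp add: act_def Rep_cons_boundary)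
    then show False using elim(2) z(2) by simp
  qed
  then show False using not_AE_False by blast
qed

abbreviation diagonal_act :: "'a letter list \<Rightarrow> 'a boundary \<times> 'a boundary \<Rightarrow> 'a boundary \<times> 'a boundary"
  where "diagonal_act s \<equiv> map_prod (act s) (act s)"

lemma measurable_diagonal_act [measurable]: "diagonal_act s \<in> measurable (\<mu> \<Otimes>\<^sub>M \<mu>) (\<mu> \<Otimes>\<^sub>M \<mu>)"
  unfolding map_prod_def by measurable

lemma space_pair [simp]: "space (\<mu> \<Otimes>\<^sub>M \<mu>) = UNIV"
  by (simp add: space_pair_measure)

lemma diagonal_act_image_eq:
  assumes "\<And>s y. s \<in> carrier free_group \<Longrightarrow> y \<in> E \<Longrightarrow> diagonal_act s y \<in> E"
    and s: "s \<in> carrier free_group"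
  shows "diagonal_act s ` E = E"
proof
  interpret group "free_group :: 'a letter list monoid" by (rule group_free_group)
  show "E \<subseteq> diagonal_act s ` E"
  proof
    fix y assume "y \<in> E"
    then have "diagonal_act (inv\<^bsub>free_group\<^esub> s) y \<in> E" using assms by simp
    moreover have "y = diagonal_act s (diagonal_act (inv\<^bsub>free_group\<^esub> s) y)"
      by (cases y) (simp add: act_inv s)
    ultimately show "y \<in> diagonal_act s ` E" by blast
  qed
qed (use assms in auto)

lemma null_or_conull:
  assumes "E \<in> sets (\<mu> \<Otimes>\<^sub>M \<mu>)"
    and "\<And>s y. s \<in> carrier free_group \<Longrightarrow> y \<in> E \<Longrightarrow> diagonal_act s y \<in> E"
  shows "(AE y in \<mu> \<Otimes>\<^sub>M \<mu>. y \<notin> E) \<or> (AE y in \<mu> \<Otimes>\<^sub>M \<mu>. y \<in> E)"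
proof -
  have "E \<in> null_sets (\<mu> \<Otimes>\<^sub>M \<mu>) \<or> - E \<in> null_sets (\<mu> \<Otimes>\<^sub>M \<mu>)"
    using double_erg assms diagonal_act_image_eq[of E]
    unfolding doubly_ergodic_def by (simp add: Compl_eq_Diff_UNIV)
  then show ?thesis
  proof
    assume "- E \<in> null_sets (\<mu> \<Otimes>\<^sub>M \<mu>)"
    then have "AE y in \<mu> \<Otimes>\<^sub>M \<mu>. y \<notin> - E" by (rule AE_not_in)
    then show ?thesis by simp
  qed (use AE_not_in in blast)
qed

text \<open>
  The diagonal is invariant, and it misses the product of two different letter cylinders, which has
  positive measure.
\<close>

lemma diagonal_null: "AE y in \<mu> \<Otimes>\<^sub>M \<mu>. fst y \<noteq> snd y"
proof -
  define D where "D = {y \<in> space (\<mu> \<Otimes>\<^sub>M \<mu>). \<forall>n. Rep_boundary (fst y) n = Rep_boundary (snd y) n}"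
  have D: "y \<in> D \<longleftrightarrow> fst y = snd y" for y
    by (simp add: D_def Rep_boundary_inject[symmetric] fun_eq_iff)
  have "D \<in> sets (\<mu> \<Otimes>\<^sub>M \<mu>)"
    unfolding D_def by measurable
  moreover have "\<not> (AE y in \<mu> \<Otimes>\<^sub>M \<mu>. y \<in> D)"
  proof
    assume D_conull: "AE y in \<mu> \<Otimes>\<^sub>M \<mu>. y \<in> D"
    obtain x y :: "'a letter" where "x \<noteq> y"
      using exists_third_letter[OF two_generators] by blast
    have "AE p in \<mu> \<Otimes>\<^sub>M \<mu>. p \<notin> {\<xi>. first_letter \<xi> = x} \<times> {\<xi>. first_letter \<xi> = y}"
      by (rule eventually_mono[OF D_conull]) (use \<open>x \<noteq> y\<close> in \<open>auto simp: D\<close>)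
    then have "{\<xi>. first_letter \<xi> = x} \<times> {\<xi>. first_letter \<xi> = y} \<in> null_sets (\<mu> \<Otimes>\<^sub>M \<mu>)"
      by (simp only: AE_iff_null_sets[OF pair_measureI[OF coordinate_set coordinate_set]])
    then have "emeasure (\<mu> \<Otimes>\<^sub>M \<mu>) ({\<xi>. first_letter \<xi> = x} \<times> {\<xi>. first_letter \<xi> = y}) = 0"
      by blast
    then show False
      using first_letter_cylinder_positive
      unfolding emeasure_pair_measure_Times[OF coordinate_set coordinate_set] by simp
  qed
  ultimately show ?thesis
    using null_or_conull[of D] by (auto simp: D)
qed

lemma singleton_set: "{\<xi>} \<in> sets \<mu>"
proof -
  have "{\<xi>} = (\<Inter>n. {\<zeta>. Rep_boundary \<zeta> n = Rep_boundary \<xi> n})"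
    by (auto simp: Rep_boundary_inject[symmetric] fun_eq_iff)
  then show ?thesis using coordinate_set by auto
qed

lemma singleton_null: "emeasure \<mu> {\<xi>} = 0"
proof -
  have "AE y in \<mu> \<Otimes>\<^sub>M \<mu>. y \<notin> {\<xi>} \<times> {\<xi>}"
    using diagonal_null by eventually_elim auto
  then have "{\<xi>} \<times> {\<xi>} \<in> null_sets (\<mu> \<Otimes>\<^sub>M \<mu>)"
    by (simp only: AE_iff_null_sets[OF pair_measureI[OF singleton_set singleton_set]])
  then have "emeasure (\<mu> \<Otimes>\<^sub>M \<mu>) ({\<xi>} \<times> {\<xi>}) = 0" by blast
  then show ?thesis
    unfolding emeasure_pair_measure_Times[OF singleton_set singleton_set] by simp
qed

text \<open>
  Without a splitting, for each \<open>n\<close> a single letter \<open>a n\<close> is the \<open>n\<close>-th letter of \<open>fst y\<close> for almost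
  all \<open>y\<close> in \<open>E\<close>. Then \<open>fst y\<close> is almost everywhere one fixed end, and \<open>E\<close> is null because \<open>\<mu>\<close> has no
  atoms.
\<close>

lemma split_positive_set:
  assumes E: "E \<in> sets (\<mu> \<Otimes>\<^sub>M \<mu>)" "E \<notin> null_sets (\<mu> \<Otimes>\<^sub>M \<mu>)"
  shows "\<exists>A B. A \<in> sets (\<mu> \<Otimes>\<^sub>M \<mu>) \<and> B \<in> sets (\<mu> \<Otimes>\<^sub>M \<mu>) \<and> A \<union> B \<subseteq> E \<and> A \<inter> B = {} \<and>
    A \<notin> null_sets (\<mu> \<Otimes>\<^sub>M \<mu>) \<and> B \<notin> null_sets (\<mu> \<Otimes>\<^sub>M \<mu>)"
proof (rule ccontr)
  assume no_split: "\<not> ?thesis"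
  define S where "S n a = {y :: 'a boundary \<times> 'a boundary. Rep_boundary (fst y) n = a}" for n and a :: "'a letter"
  have S: "S n a \<in> sets (\<mu> \<Otimes>\<^sub>M \<mu>)" for n a
  proof -
    have "{y \<in> space (\<mu> \<Otimes>\<^sub>M \<mu>). Rep_boundary (fst y) n = a} \<in> sets (\<mu> \<Otimes>\<^sub>M \<mu>)"
      by measurable
    then show ?thesis by (simp add: S_def)
  qed
  have dichotomy: "E \<inter> S n a \<in> null_sets (\<mu> \<Otimes>\<^sub>M \<mu>) \<or> E - S n a \<in> null_sets (\<mu> \<Otimes>\<^sub>M \<mu>)" for n a
  proof (rule ccontr)
    assume neither_null: "\<not> ?thesis"
    have "E \<inter> S n a \<in> sets (\<mu> \<Otimes>\<^sub>M \<mu>) \<and> E - S n a \<in> sets (\<mu> \<Otimes>\<^sub>M \<mu>) \<and>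
      (E \<inter> S n a) \<union> (E - S n a) \<subseteq> E \<and> (E \<inter> S n a) \<inter> (E - S n a) = {} \<and>
      E \<inter> S n a \<notin> null_sets (\<mu> \<Otimes>\<^sub>M \<mu>) \<and> E - S n a \<notin> null_sets (\<mu> \<Otimes>\<^sub>M \<mu>)"
      using E(1) S[of n a] neither_null by auto
    then show False using no_split by (elim notE) (intro exI)
  qed
  have "\<exists>a. E - S n a \<in> null_sets (\<mu> \<Otimes>\<^sub>M \<mu>)" for n
  proof (rule ccontr)
    assume "\<not> ?thesis"
    then have "(\<Union>a. E \<inter> S n a) \<in> null_sets (\<mu> \<Otimes>\<^sub>M \<mu>)"
      using dichotomy by (intro null_sets_UN) blast
    moreover have "(\<Union>a. E \<inter> S n a) = E" by (auto simp: S_def)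
    ultimately show False using E(2) by simp
  qed
  then obtain a where a: "\<And>n. E - S n (a n) \<in> null_sets (\<mu> \<Otimes>\<^sub>M \<mu>)" by metis
  have tail: "(\<Union>n. E - S n (a n)) \<in> null_sets (\<mu> \<Otimes>\<^sub>M \<mu>)"
    using a by (intro null_sets_UN)
  have "E \<subseteq> (\<Union>n. E - S n (a n)) \<union> {Abs_boundary a} \<times> UNIV"
  proof
    fix y assume "y \<in> E"
    show "y \<in> (\<Union>n. E - S n (a n)) \<union> {Abs_boundary a} \<times> UNIV"
    proof (cases "\<forall>n. y \<in> S n (a n)")
      case True
      then have "Rep_boundary (fst y) = a" by (auto simp: S_def)
      then have "fst y = Abs_boundary a" by (metis Rep_boundary_inverse)
      then show ?thesis by (cases y) auto
    qed (use \<open>y \<in> E\<close> in auto)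
  qed
  moreover have "{Abs_boundary a} \<times> UNIV \<in> null_sets (\<mu> \<Otimes>\<^sub>M \<mu>)"
    using emeasure_pair_measure_Times[OF singleton_set[of "Abs_boundary a"] sets.top[of \<mu>]]
      pair_measureI[OF singleton_set[of "Abs_boundary a"] sets.top[of \<mu>]]
    by (simp add: null_sets_def singleton_null)
  ultimately have "E \<in> null_sets (\<mu> \<Otimes>\<^sub>M \<mu>)"
    using tail E(1) by (meson null_sets.Un null_sets_subset)
  then show False using E(2) by blast
qed

lemma disjoint_positive_subsets:
  fixes n :: nat
  assumes "E \<in> sets (\<mu> \<Otimes>\<^sub>M \<mu>)" "E \<notin> null_sets (\<mu> \<Otimes>\<^sub>M \<mu>)"
  shows "\<exists>A. (\<forall>i<n. A i \<in> sets (\<mu> \<Otimes>\<^sub>M \<mu>) \<and> A i \<subseteq> E \<and> A i \<notin> null_sets (\<mu> \<Otimes>\<^sub>M \<mu>)) \<and>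
    (\<forall>i<n. \<forall>j<n. i \<noteq> j \<longrightarrow> A i \<inter> A j = {})"
  using assms
proof (induction n arbitrary: E)
  case (Suc n)
  obtain B C where BC: "B \<in> sets (\<mu> \<Otimes>\<^sub>M \<mu>)" "C \<in> sets (\<mu> \<Otimes>\<^sub>M \<mu>)" "B \<union> C \<subseteq> E" "B \<inter> C = {}"
    "B \<notin> null_sets (\<mu> \<Otimes>\<^sub>M \<mu>)" "C \<notin> null_sets (\<mu> \<Otimes>\<^sub>M \<mu>)"
    using split_positive_set[OF Suc.prems] by blast
  obtain A where A: "\<forall>i<n. A i \<in> sets (\<mu> \<Otimes>\<^sub>M \<mu>) \<and> A i \<subseteq> C \<and> A i \<notin> null_sets (\<mu> \<Otimes>\<^sub>M \<mu>)"
    "\<forall>i<n. \<forall>j<n. i \<noteq> j \<longrightarrow> A i \<inter> A j = {}"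
    using Suc.IH[OF BC(2,6)] by blast
  define A' where "A' = A(n := B)"
  have "A' i \<in> sets (\<mu> \<Otimes>\<^sub>M \<mu>) \<and> A' i \<subseteq> E \<and> A' i \<notin> null_sets (\<mu> \<Otimes>\<^sub>M \<mu>)" if "i < Suc n" for i
    using that A(1)[rule_format, of i] BC(1,3,5) by (cases "i = n") (auto simp: A'_def)
  moreover have "A' i \<inter> A' j = {}" if "i < Suc n" "j < Suc n" "i \<noteq> j" for i j
  proof -
    have "A k \<inter> B = {}" if "k < n" for k
      using A(1)[rule_format, OF that] BC(4) by auto
    then show ?thesis
      using that A(2)[rule_format, of i j] unfolding A'_def
      by (cases "i = n"; cases "j = n") (simp_all add: Int_commute)
  qed
  ultimately show ?case by (intro exI[of _ A']) simp
qed simp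

text \<open>
  The union of the translates of \<open>A\<close> is invariant and contains \<open>A\<close>, so ergodicity makes it conull.
\<close>

lemma orbit_meets_positive_set:
  assumes A: "A \<in> sets (\<mu> \<Otimes>\<^sub>M \<mu>)" "A \<notin> null_sets (\<mu> \<Otimes>\<^sub>M \<mu>)"
  shows "AE y in \<mu> \<Otimes>\<^sub>M \<mu>. \<exists>s\<in>carrier free_group. diagonal_act s y \<in> A"
proof -
  interpret group "free_group :: 'a letter list monoid" by (rule group_free_group)
  define S where "S = (\<Union>s\<in>carrier free_group. diagonal_act s -` A)"
  have "diagonal_act s -` A \<in> sets (\<mu> \<Otimes>\<^sub>M \<mu>)" for s
    using measurable_sets[OF measurable_diagonal_act A(1)] by simp
  then have S: "S \<in> sets (\<mu> \<Otimes>\<^sub>M \<mu>)"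
    unfolding S_def by (intro sets.countable_UN') auto
  have "diagonal_act s y \<in> S" if s: "s \<in> carrier free_group" and "y \<in> S" for s y
  proof -
    obtain t where t: "t \<in> carrier free_group" "diagonal_act t y \<in> A"
      using \<open>y \<in> S\<close> by (auto simp: S_def)
    then have "diagonal_act (t \<otimes>\<^bsub>free_group\<^esub> inv\<^bsub>free_group\<^esub> s) (diagonal_act s y) \<in> A"
      using s by (cases y) (simp add: act_mult act_inv)
    then show ?thesis unfolding S_def using s t(1) by blast
  qed
  then consider "AE y in \<mu> \<Otimes>\<^sub>M \<mu>. y \<notin> S" | "AE y in \<mu> \<Otimes>\<^sub>M \<mu>. y \<in> S"
    using null_or_conull[OF S] by blast
  then show ?thesis
  proof cases
    case 1
    have "A \<subseteq> S"
    proof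
      fix y assume "y \<in> A"
      then have "diagonal_act \<one>\<^bsub>free_group\<^esub> y \<in> A" by (cases y) (simp add: act_one)
      then show "y \<in> S" unfolding S_def by blast
    qed
    then have "AE y in \<mu> \<Otimes>\<^sub>M \<mu>. y \<notin> A" by (intro eventually_mono[OF 1]) auto
    then show ?thesis using A AE_iff_null_sets[OF A(1)] by blast
  next
    case 2
    then show ?thesis by (rule eventually_mono) (auto simp: S_def)
  qed
qed

text \<open>
  An ergodic action on a space without atoms is not dissipative. Visits of one orbit to disjoint sets
  \<open>A i\<close> come from different group elements, each visit contributes more than a fixed \<open>\<epsilon>\<close>, and the number
  \<open>n\<close> of sets is arbitrary.
\<close>

lemma summable_on_orbits_imp_nonpos:
  fixes F :: "'a boundary \<times> 'a boundary \<Rightarrow> real"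
  assumes F [measurable]: "F \<in> borel_measurable (\<mu> \<Otimes>\<^sub>M \<mu>)"
    and bound: "AE y in \<mu> \<Otimes>\<^sub>M \<mu>. \<forall>T. finite T \<and> T \<subseteq> carrier free_group \<longrightarrow>
      (\<Sum>s\<in>T. F (diagonal_act s y)) \<le> K"
  shows "AE y in \<mu> \<Otimes>\<^sub>M \<mu>. F y \<le> 0"
proof -
  have "AE y in \<mu> \<Otimes>\<^sub>M \<mu>. F y \<le> inverse (real (Suc k))" for k
  proof (rule ccontr)
    define E where "E = {y \<in> space (\<mu> \<Otimes>\<^sub>M \<mu>). \<not> F y \<le> inverse (real (Suc k))}"
    have E: "E \<in> sets (\<mu> \<Otimes>\<^sub>M \<mu>)" unfolding E_def by measurable
    assume "\<not> (AE y in \<mu> \<Otimes>\<^sub>M \<mu>. F y \<le> inverse (real (Suc k)))"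
    then have E_pos: "E \<notin> null_sets (\<mu> \<Otimes>\<^sub>M \<mu>)"
      using AE_iff_null_sets[OF E] by (auto simp: E_def)
    obtain n :: nat where n: "K * real (Suc k) < real n"
      using reals_Archimedean2 by blast
    obtain A where "(\<forall>i<n. A i \<in> sets (\<mu> \<Otimes>\<^sub>M \<mu>) \<and> A i \<subseteq> E \<and> A i \<notin> null_sets (\<mu> \<Otimes>\<^sub>M \<mu>)) \<and>
        (\<forall>i<n. \<forall>j<n. i \<noteq> j \<longrightarrow> A i \<inter> A j = {})"
      using disjoint_positive_subsets[OF E E_pos, of n] by (rule exE)
    then have A: "\<And>i. i < n \<Longrightarrow> A i \<in> sets (\<mu> \<Otimes>\<^sub>M \<mu>)" "\<And>i. i < n \<Longrightarrow> A i \<subseteq> E"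
      "\<And>i. i < n \<Longrightarrow> A i \<notin> null_sets (\<mu> \<Otimes>\<^sub>M \<mu>)"
      "\<And>i j. i < n \<Longrightarrow> j < n \<Longrightarrow> i \<noteq> j \<Longrightarrow> A i \<inter> A j = {}"
      by simp_all
    have "AE y in \<mu> \<Otimes>\<^sub>M \<mu>. \<forall>i\<in>{..<n}. \<exists>s\<in>carrier free_group. diagonal_act s y \<in> A i"
      using A(1,3) by (intro AE_finite_allI orbit_meets_positive_set) auto
    with bound have "AE y in \<mu> \<Otimes>\<^sub>M \<mu>. False"
    proof eventually_elim
      case (elim y)
      then obtain s where s: "\<And>i. i < n \<Longrightarrow> s i \<in> carrier free_group"
        "\<And>i. i < n \<Longrightarrow> diagonal_act (s i) y \<in> A i"
        by (metis lessThan_iff)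
      have inj: "inj_on s {..<n}"
      proof (rule inj_onI)
        fix i j assume "i \<in> {..<n}" "j \<in> {..<n}" "s i = s j"
        then show "i = j" using s(2)[of i] s(2)[of j] A(4)[of i j] by auto
      qed
      have "real n * inverse (real (Suc k)) = (\<Sum>i<n. inverse (real (Suc k)))" by simp
      also have "\<dots> \<le> (\<Sum>i<n. F (diagonal_act (s i) y))"
        using s(2) A(2) by (intro sum_mono) (force simp: E_def)
      also have "\<dots> = (\<Sum>t\<in>s ` {..<n}. F (diagonal_act t y))"
        by (simp add: sum.reindex[OF inj])
      also have "\<dots> \<le> K" using elim(1) s(1) by (auto simp: image_subset_iff)
      finally have "real n \<le> K * real (Suc k)" by (simp add: field_simps)
      then show False using n by simp
    qed
    then have "E \<in> null_sets (\<mu> \<Otimes>\<^sub>M \<mu>)"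
      unfolding AE_iff_null_sets[OF E] by (rule eventually_mono) simp
    then show False using E_pos by blast
  qed
  then have "AE y in \<mu> \<Otimes>\<^sub>M \<mu>. \<forall>k. F y \<le> inverse (real (Suc k))"
    by (simp add: AE_all_countable)
  then show ?thesis
  proof eventually_elim
    case (elim y)
    then show ?case by (metis not_le reals_Archimedean)
  qed
qed

end

section \<open>Equivariant positive operators\<close>

definition prefix_indicator :: "'a letter list \<Rightarrow> 'a boundary \<Rightarrow> complex" where
  "prefix_indicator w \<zeta> = of_bool (boundary_prefix (length w) \<zeta> = w)"

lemma boundary_prefix_1: "boundary_prefix (Suc 0) \<zeta> = [first_letter \<zeta>]"
  by (simp add: boundary_prefix_def)

lemma prefix_indicator_single [simp]: "prefix_indicator [x] \<zeta> = of_bool (first_letter \<zeta> = x)"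
  by (simp add: prefix_indicator_def boundary_prefix_1)

text \<open>
  A cylinder of a longer word is a translate of the cylinder of its tail, which reduces statements
  about all cylinders to single letters by equivariance.
\<close>

lemma prefix_indicator_Cons:
  "prefix_indicator (x # y # w) =
    (if y = letter_inv x then (\<lambda>_. 0) else translate [x] (prefix_indicator (y # w)))"
proof (cases "y = letter_inv x")
  case True
  have "boundary_prefix (Suc (Suc (length w))) \<zeta> \<noteq> x # y # w" for \<zeta>
  proof
    assume *: "boundary_prefix (Suc (Suc (length w))) \<zeta> = x # y # w"
    have "boundary_prefix (Suc (Suc (length w))) \<zeta> ! i = Rep_boundary \<zeta> i" if "i < 2" for i
      using that unfolding boundary_prefix_def by (subst nth_map) (simp_all del: upt_Suc)
    from this[of 0] this[of 1] show False
      using Rep_boundary_Suc[of \<zeta> 0] True by (simp add: *)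
  qed
  then show ?thesis using True by (simp add: prefix_indicator_def fun_eq_iff)
next
  case False
  then show ?thesis
    by (simp add: prefix_indicator_def fun_eq_iff translate_def act_inv_generator
        boundary_prefix_Suc_Suc_eq)
qed

lemma C_boundary_const [simp]: "(\<lambda>_. c) \<in> C_boundary"
  by (simp add: C_boundary_def)

lemma C_boundary_add: "f \<in> C_boundary \<Longrightarrow> g \<in> C_boundary \<Longrightarrow> (\<lambda>\<xi>. f \<xi> + g \<xi>) \<in> C_boundary"
  by (simp add: C_boundary_def continuous_on_add)

lemma C_boundary_scale: "f \<in> C_boundary \<Longrightarrow> (\<lambda>\<xi>. c * f \<xi>) \<in> C_boundary"
  by (simp add: C_boundary_def continuous_on_mult_left)

lemma C_boundary_sum: "(\<And>p. p \<in> P \<Longrightarrow> f p \<in> C_boundary) \<Longrightarrow> (\<lambda>\<xi>. \<Sum>p\<in>P. f p \<xi>) \<in> C_boundary"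
  by (simp add: C_boundary_def continuous_on_sum)

lemma C_boundary_act: "f \<in> C_boundary \<Longrightarrow> (\<lambda>\<xi>. f (act s \<xi>)) \<in> C_boundary"
  unfolding C_boundary_def
  using continuous_on_compose2[of UNIV f UNIV "act s"] continuous_act by auto

lemma C_boundary_prefix_indicator: "prefix_indicator w \<in> C_boundary"
proof (induction w rule: induct_list012)
  case 1
  show ?case by (simp add: prefix_indicator_def[abs_def] boundary_prefix_def)
next
  case (2 x)
  have "open {\<xi>. first_letter \<xi> = x}" "open (- {\<xi>. first_letter \<xi> = x})"
  proof -
    have "- {\<xi>. first_letter \<xi> = x} = (\<Union>y\<in>-{x}. {\<xi>. first_letter \<xi> = y})" by auto
    then show "open (- {\<xi>. first_letter \<xi> = x})" by (simp add: open_UN open_letter)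
  qed (rule open_letter)
  then have "continuous_on ({\<xi>. first_letter \<xi> = x} \<union> - {\<xi>. first_letter \<xi> = x}) (prefix_indicator [x])"
    by (intro continuous_on_open_Un) (auto cong: continuous_on_cong_simp simp: prefix_indicator_single)
  then show ?case by (simp add: C_boundary_def)
next
  case (3 x y w)
  then show ?case
    using C_boundary_act[OF 3(2)] by (simp add: prefix_indicator_Cons translate_def[abs_def])
qed

text \<open>
  The operator \<open>R\<close> picks, for every continuous function, a representative of its image in \<open>L\<^sup>\<infinity>\<close>.
  Equations between classes become equations almost everywhere.
\<close>

locale equivariant_operator = doubly_ergodic_boundary \<mu> for \<mu> :: "'a::finite boundary measure" +
  fixes R :: "('a boundary \<Rightarrow> complex) \<Rightarrow> 'a boundary \<Rightarrow> complex"
  assumes R_measurable: "f \<in> C_boundary \<Longrightarrow> R f \<in> borel_measurable \<mu>"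
    and R_add: "f \<in> C_boundary \<Longrightarrow> g \<in> C_boundary \<Longrightarrow> AE \<xi> in \<mu>. R (\<lambda>\<zeta>. f \<zeta> + g \<zeta>) \<xi> = R f \<xi> + R g \<xi>"
    and R_scale: "f \<in> C_boundary \<Longrightarrow> AE \<xi> in \<mu>. R (\<lambda>\<zeta>. c * f \<zeta>) \<xi> = c * R f \<xi>"
    and R_one: "AE \<xi> in \<mu>. R (\<lambda>_. 1) \<xi> = 1"
    and R_nonneg: "f \<in> C_boundary \<Longrightarrow> (\<And>\<zeta>. f \<zeta> \<in> \<real>\<^sub>\<ge>\<^sub>0) \<Longrightarrow> AE \<xi> in \<mu>. R f \<xi> \<in> \<real>\<^sub>\<ge>\<^sub>0"
    and R_translate: "f \<in> C_boundary \<Longrightarrow> s \<in> carrier free_group \<Longrightarrow>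
      AE \<xi> in \<mu>. R (translate s f) \<xi> = translate s (R f) \<xi>"
begin

lemma R_zero: "AE \<xi> in \<mu>. R (\<lambda>_. 0) \<xi> = 0"
  using R_scale[of "\<lambda>_. 1" 0] by simp

lemma R_const: "AE \<xi> in \<mu>. R (\<lambda>_. c) \<xi> = c"
  using R_scale[OF C_boundary_const[of 1], of c] R_one by eventually_elim simp

lemma R_sum:
  assumes "finite P" "\<And>p. p \<in> P \<Longrightarrow> f p \<in> C_boundary"
  shows "AE \<xi> in \<mu>. R (\<lambda>\<zeta>. \<Sum>p\<in>P. f p \<zeta>) \<xi> = (\<Sum>p\<in>P. R (f p) \<xi>)"
  using assms
proof (induction P rule: finite_induct)
  case empty
  show ?case using R_zero by simp
next
  case (insert p P)
  have "AE \<xi> in \<mu>. R (\<lambda>\<zeta>. f p \<zeta> + (\<Sum>p\<in>P. f p \<zeta>)) \<xi> = R (f p) \<xi> + R (\<lambda>\<zeta>. \<Sum>p\<in>P. f p \<zeta>) \<xi>"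
    using insert.prems by (intro R_add C_boundary_sum) auto
  moreover have "AE \<xi> in \<mu>. R (\<lambda>\<zeta>. \<Sum>p\<in>P. f p \<zeta>) \<xi> = (\<Sum>p\<in>P. R (f p) \<xi>)"
    using insert by blast
  ultimately show ?case
    by eventually_elim (simp add: insert.hyps)
qed

lemma R_mono:
  fixes u v :: "'a boundary \<Rightarrow> real"
  assumes "(\<lambda>\<zeta>. of_real (u \<zeta>)) \<in> C_boundary" "(\<lambda>\<zeta>. of_real (v \<zeta>)) \<in> C_boundary" "\<And>\<zeta>. u \<zeta> \<le> v \<zeta>"
  shows "AE \<xi> in \<mu>. R (\<lambda>\<zeta>. of_real (v \<zeta>)) \<xi> - R (\<lambda>\<zeta>. of_real (u \<zeta>)) \<xi> \<in> \<real>\<^sub>\<ge>\<^sub>0"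
proof -
  have "AE \<xi> in \<mu>. R (\<lambda>\<zeta>. of_real (v \<zeta>) + (-1) * of_real (u \<zeta>)) \<xi> \<in> \<real>\<^sub>\<ge>\<^sub>0"
    using assms by (intro R_nonneg C_boundary_add C_boundary_scale)
      (auto simp flip: of_real_diff)
  with R_add[OF assms(2) C_boundary_scale[OF assms(1), of "-1"]] R_scale[OF assms(1), of "-1"]
  show ?thesis by eventually_elim simp
qed

lemma R_act:
  assumes "f \<in> C_boundary" "s \<in> carrier free_group"
  shows "AE \<xi> in \<mu>. R (\<lambda>\<zeta>. f (act s \<zeta>)) \<xi> = R f (act s \<xi>)"
proof -
  interpret group "free_group :: 'a letter list monoid" by (rule group_free_group)
  show ?thesis
    using R_translate[OF assms(1) inv_closed[OF assms(2)]] assms(2) by (simp add: translate_def)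
qed

text \<open>
  In terms of the random measures of the introduction, this is the \<open>\<nu>\<^sub>\<xi>\<close>-mass of the ends that begin
  with \<open>x\<close>; by equivariance \<open>first_letter_mass x (act s \<xi>)\<close> is the \<open>\<nu>\<^sub>\<xi>\<close>-mass of the ends \<open>\<zeta>\<close> such that
  \<open>act s \<zeta>\<close> begins with \<open>x\<close>.
\<close>

definition first_letter_mass :: "'a letter \<Rightarrow> 'a boundary \<Rightarrow> real" where
  "first_letter_mass x \<xi> = Re (R (prefix_indicator [x]) \<xi>)"

lemma first_letter_mass_measurable [measurable]: "first_letter_mass x \<in> borel_measurable \<mu>"
  unfolding first_letter_mass_def[abs_def]
  by (intro measurable_compose[OF R_measurable[OF C_boundary_prefix_indicator] borel_measurable_Re])

lemma R_first_letter:
  "AE \<xi> in \<mu>. R (prefix_indicator [x]) \<xi> = of_real (first_letter_mass x \<xi>) \<and> 0 \<le> first_letter_mass x \<xi>"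
proof -
  have "AE \<xi> in \<mu>. R (prefix_indicator [x]) \<xi> \<in> \<real>\<^sub>\<ge>\<^sub>0"
    by (intro R_nonneg C_boundary_prefix_indicator) simp
  then show ?thesis
    by eventually_elim (auto simp: first_letter_mass_def elim!: nonneg_Reals_cases)
qed

text \<open>
  A pair \<open>(s, x)\<close> stands for the set of ends \<open>\<zeta>\<close> such that \<open>act s \<zeta>\<close> begins with \<open>x\<close>; these sets are to be
  pairwise disjoint.
\<close>

definition separating :: "('a letter list \<times> 'a letter) set \<Rightarrow> bool" where
  "separating P \<longleftrightarrow> (\<forall>\<zeta>. \<forall>p\<in>P. \<forall>q\<in>P.
    first_letter (act (fst p) \<zeta>) = snd p \<longrightarrow> first_letter (act (fst q) \<zeta>) = snd q \<longrightarrow> p = q)"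

text \<open>
  Indicators of disjoint sets add up to at most \<open>1\<close>, and \<open>R\<close> is positive and unital. The exceptional
  null set can be chosen for all \<open>P\<close> at once because there are only countably many of them.
\<close>

lemma mass_of_disjoint_sets_le_1:
  "AE \<xi> in \<mu>. \<forall>P. finite P \<and> P \<subseteq> carrier free_group \<times> UNIV \<and> separating P
      \<longrightarrow> (\<Sum>(s, x)\<in>P. first_letter_mass x (act s \<xi>)) \<le> 1"
proof -
  define \<P> where "\<P> = {P :: ('a letter list \<times> 'a letter) set. finite P \<and> P \<subseteq> carrier free_group \<times> UNIV \<and> separating P}"
  have "countable \<P>"
    by (rule countable_subset[OF _ countable_Collect_finite]) (auto simp: \<P>_def)
  moreover have "AE \<xi> in \<mu>. (\<Sum>(s, x)\<in>P. first_letter_mass x (act s \<xi>)) \<le> 1" if "P \<in> \<P>" for P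
  proof -
    define f where "f p \<zeta> = prefix_indicator [snd p] (act (fst p) \<zeta>)" for p :: "'a letter list \<times> 'a letter" and \<zeta>
    define u where "u \<zeta> = (\<Sum>p\<in>P. of_bool (first_letter (act (fst p) \<zeta>) = snd p) :: real)" for \<zeta>
    have P: "finite P" "\<And>p. p \<in> P \<Longrightarrow> fst p \<in> carrier free_group"
      "\<And>\<zeta> p q. p \<in> P \<Longrightarrow> q \<in> P \<Longrightarrow> first_letter (act (fst p) \<zeta>) = snd p \<Longrightarrow>
        first_letter (act (fst q) \<zeta>) = snd q \<Longrightarrow> p = q"
      using that unfolding \<P>_def separating_def by auto
    have f: "f p \<in> C_boundary" for p
      unfolding f_def[abs_def] by (intro C_boundary_act C_boundary_prefix_indicator)
    have f_sum: "(\<Sum>p\<in>P. f p \<zeta>) = of_real (u \<zeta>)" for \<zeta>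
      by (simp add: f_def u_def of_bool_def if_distrib[of of_real] cong: if_cong)
    have u_le: "u \<zeta> \<le> 1" for \<zeta>
    proof (cases "\<exists>p\<in>P. first_letter (act (fst p) \<zeta>) = snd p")
      case True
      then obtain p where p: "p \<in> P" "first_letter (act (fst p) \<zeta>) = snd p" by blast
      have "of_bool (first_letter (act (fst q) \<zeta>) = snd q) = (if q = p then 1 else 0 :: real)"
        if "q \<in> P" for q
        using P(3)[OF p(1) that p(2)] p(2) by (cases "q = p") auto
      then have "u \<zeta> = (\<Sum>q\<in>P. if q = p then 1 else 0)"
        unfolding u_def by (rule sum.cong[OF refl])
      then show ?thesis using P(1) p(1) by simp
    qed (simp add: u_def)
    have "AE \<xi> in \<mu>. R (\<lambda>\<zeta>. of_real 1) \<xi> - R (\<lambda>\<zeta>. of_real (u \<zeta>)) \<xi> \<in> \<real>\<^sub>\<ge>\<^sub>0"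
      using C_boundary_sum[of P f] f u_le by (intro R_mono) (simp_all add: f_sum)
    moreover have "AE \<xi> in \<mu>. R (\<lambda>\<zeta>. of_real (u \<zeta>)) \<xi> = (\<Sum>p\<in>P. R (f p) \<xi>)"
      using R_sum[of P f] P(1) f by (simp add: f_sum)
    moreover have "AE \<xi> in \<mu>. \<forall>p\<in>P. R (f p) \<xi> = R (prefix_indicator [snd p]) (act (fst p) \<xi>)"
      unfolding f_def[abs_def] using P(1,2)
      by (intro AE_finite_allI R_act C_boundary_prefix_indicator) auto
    ultimately show ?thesis
      using R_one
    proof eventually_elim
      case (elim \<xi>)
      have "(case p of (s, x) \<Rightarrow> first_letter_mass x (act s \<xi>)) = Re (R (f p) \<xi>)" if "p \<in> P" for p
        using elim(3) that by (simp add: case_prod_unfold first_letter_mass_def)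
      then have "(\<Sum>(s, x)\<in>P. first_letter_mass x (act s \<xi>)) = Re (\<Sum>p\<in>P. R (f p) \<xi>)"
        unfolding Re_sum by (rule sum.cong[OF refl])
      moreover have "1 - (\<Sum>p\<in>P. R (f p) \<xi>) \<in> \<real>\<^sub>\<ge>\<^sub>0"
        using elim(1) unfolding elim(2) of_real_1 elim(4) .
      then have "Re (\<Sum>p\<in>P. R (f p) \<xi>) \<le> 1"
        unfolding complex_nonneg_Reals_iff by (simp del: Re_sum)
      ultimately show ?case by simp
    qed
  qed
  ultimately have "AE \<xi> in \<mu>. \<forall>P\<in>\<P>. (\<Sum>(s, x)\<in>P. first_letter_mass x (act s \<xi>)) \<le> 1"
    by (simp add: AE_ball_countable)
  then show ?thesis unfolding \<P>_def by (rule eventually_mono) blast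
qed

text \<open>
  This is the function \<open>F\<close> of the introduction: the condition on the three letters says that the
  identity lies on the geodesic between the two ends and that the ends which begin with \<open>x\<close> project
  to it.
\<close>

definition mass_at_identity :: "'a boundary \<times> 'a boundary \<Rightarrow> real" where
  "mass_at_identity p = (\<Sum>x\<in>UNIV.
    if distinct [first_letter (fst p), first_letter (snd p), x] then first_letter_mass x (fst p) else 0)"

lemma mass_at_identity_measurable [measurable]: "mass_at_identity \<in> borel_measurable (\<mu> \<Otimes>\<^sub>M \<mu>)"
  unfolding mass_at_identity_def[abs_def] by simp

text \<open>
  The exceptional null set concerns \<open>fst y\<close> only. For all other \<open>y\<close>, uniqueness of centres makes the
  sets of ends that project to different vertices disjoint.
\<close>

lemma mass_along_geodesic_le_1:
  "AE y in \<mu> \<Otimes>\<^sub>M \<mu>. \<forall>T. finite T \<and> T \<subseteq> carrier free_group \<longrightarrow>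
    (\<Sum>s\<in>T. mass_at_identity (diagonal_act s y)) \<le> 1"
proof -
  obtain N where N: "N \<in> null_sets \<mu>"
    and good: "\<And>\<xi> P. \<xi> \<notin> N \<Longrightarrow> finite P \<Longrightarrow> P \<subseteq> carrier free_group \<times> UNIV \<Longrightarrow> separating P \<Longrightarrow>
      (\<Sum>(s, x)\<in>P. first_letter_mass x (act s \<xi>)) \<le> 1"
    by (rule AE_E3[OF mass_of_disjoint_sets_le_1]) simp
  have "N \<times> UNIV \<in> null_sets (\<mu> \<Otimes>\<^sub>M \<mu>)"
    using times_in_null_sets1[OF N sets.top[of \<mu>]] by simp
  then have "AE y in \<mu> \<Otimes>\<^sub>M \<mu>. y \<notin> N \<times> UNIV" by (rule AE_not_in)
  then show ?thesis
  proof (rule eventually_mono, intro allI impI, elim conjE)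
    fix y :: "'a boundary \<times> 'a boundary" and T :: "'a letter list set"
    assume y: "y \<notin> N \<times> (UNIV :: 'a boundary set)" and T: "finite T" "T \<subseteq> carrier free_group"
    obtain \<xi> \<eta> where y_eq: "y = (\<xi>, \<eta>)" by fastforce
    define D where "D s = {x. distinct [first_letter (act s \<xi>), first_letter (act s \<eta>), x]}" for s
    have "(\<Sum>s\<in>T. mass_at_identity (diagonal_act s y)) = (\<Sum>s\<in>T. \<Sum>x\<in>D s. first_letter_mass x (act s \<xi>))"
      by (simp add: mass_at_identity_def y_eq D_def sum.If_cases)
    also have "\<dots> = (\<Sum>(s, x)\<in>Sigma T D. first_letter_mass x (act s \<xi>))"
      using T(1) by (intro sum.Sigma) auto
    also have "\<dots> \<le> 1"
    proof (rule good)
      show "separating (Sigma T D)"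
        unfolding separating_def
      proof (intro allI ballI impI)
        fix \<zeta> p q
        assume pq: "p \<in> Sigma T D" "q \<in> Sigma T D"
          "first_letter (act (fst p) \<zeta>) = snd p" "first_letter (act (fst q) \<zeta>) = snd q"
        then have "fst p = fst q"
          using T(2) by (intro centre_unique[of "fst p" "fst q" \<xi> \<eta> \<zeta>]) (auto simp: D_def)
        then show "p = q" using pq(3,4) by (metis prod_eqI)
      qed
    qed (use y T in \<open>auto simp: y_eq\<close>)
    finally show "(\<Sum>s\<in>T. mass_at_identity (diagonal_act s y)) \<le> 1" .
  qed
qed

text \<open>
  Since \<open>mass_at_identity\<close> vanishes, an end \<open>\<eta>\<close> whose first letter is neither that of \<open>\<xi>\<close> nor \<open>x\<close> witnesses
  that \<open>\<nu>\<^sub>\<xi>\<close> gives no mass to the ends that begin with \<open>x\<close>. All mass is then left to the first letter of \<open>\<xi>\<close>.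
\<close>

lemma R_first_letter_eq: "AE \<xi> in \<mu>. R (prefix_indicator [x]) \<xi> = prefix_indicator [x] \<xi>"
proof -
  have "AE y in \<mu> \<Otimes>\<^sub>M \<mu>. mass_at_identity y \<le> 0"
    using summable_on_orbits_imp_nonpos[OF mass_at_identity_measurable mass_along_geodesic_le_1] .
  then have "AE \<xi> in \<mu>. AE \<eta> in \<mu>. mass_at_identity (\<xi>, \<eta>) \<le> 0"
    by (rule pair.AE_pair)
  moreover have nonneg: "AE \<xi> in \<mu>. \<forall>x\<in>UNIV. R (prefix_indicator [x]) \<xi> = of_real (first_letter_mass x \<xi>) \<and>
      0 \<le> first_letter_mass x \<xi>"
    by (intro AE_finite_allI R_first_letter) simp
  ultimately have zero: "AE \<xi> in \<mu>. \<forall>x. first_letter \<xi> \<noteq> x \<longrightarrow> R (prefix_indicator [x]) \<xi> = 0"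
  proof eventually_elim
    case (elim \<xi>)
    show ?case
    proof (intro allI impI)
      fix x assume x: "first_letter \<xi> \<noteq> x"
      obtain z where z: "z \<noteq> first_letter \<xi>" "z \<noteq> x"
        using exists_third_letter[OF two_generators] by blast
      obtain \<eta> where \<eta>: "first_letter \<eta> = z" "mass_at_identity (\<xi>, \<eta>) \<le> 0"
      proof (rule ccontr)
        assume "\<not> thesis"
        then have "AE \<eta> in \<mu>. \<eta> \<notin> {\<eta>. first_letter \<eta> = z}"
          using elim(1) that by (intro eventually_mono[OF elim(1)]) auto
        then have "{\<eta>. first_letter \<eta> = z} \<in> null_sets \<mu>"
          by (simp only: AE_iff_null_sets[OF coordinate_set])
        then show False using first_letter_cylinder_positive by blast
      qed
      have "first_letter_mass x \<xi> \<le> mass_at_identity (\<xi>, \<eta>)"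
        unfolding mass_at_identity_def
        by (rule order_trans[OF _ member_le_sum[of x]]) (use x z \<eta>(1) elim(2) in auto)
      then show "R (prefix_indicator [x]) \<xi> = 0"
        using \<eta>(2) elim(2) by (simp add: order_antisym)
    qed
  qed
  have "(\<Sum>x\<in>UNIV. prefix_indicator [x] \<zeta>) = 1" for \<zeta> :: "'a boundary"
    by simp
  then have "AE \<xi> in \<mu>. R (\<lambda>_. 1) \<xi> = (\<Sum>x\<in>UNIV. R (prefix_indicator [x]) \<xi>)"
    using R_sum[of UNIV "\<lambda>x. prefix_indicator [x]", OF finite C_boundary_prefix_indicator] by simp
  with zero R_one show ?thesis
  proof eventually_elim
    case (elim \<xi>)
    have "(\<Sum>x\<in>UNIV. R (prefix_indicator [x]) \<xi>) = (\<Sum>x\<in>{first_letter \<xi>}. R (prefix_indicator [x]) \<xi>)"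
      using elim(1) by (intro sum.mono_neutral_right) auto
    then have "R (prefix_indicator [first_letter \<xi>]) \<xi> = 1" using elim by simp
    then show ?case using elim(1) by auto
  qed
qed

lemma R_prefix_indicator_eq: "AE \<xi> in \<mu>. R (prefix_indicator w) \<xi> = prefix_indicator w \<xi>"
proof (induction w rule: induct_list012)
  case 1
  show ?case using R_one by (simp add: prefix_indicator_def[abs_def] boundary_prefix_def)
next
  case (2 x)
  show ?case by (rule R_first_letter_eq)
next
  case (3 x y w)
  show ?case
  proof (cases "y = letter_inv x")
    case True
    then show ?thesis using R_zero by (simp add: prefix_indicator_Cons)
  next
    case False
    have "AE \<xi> in \<mu>. R (translate [x] (prefix_indicator (y # w))) \<xi> = translate [x] (R (prefix_indicator (y # w))) \<xi>"
      by (intro R_translate C_boundary_prefix_indicator generator_in_free_group)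
    moreover have "AE \<xi> in \<mu>. translate [x] (R (prefix_indicator (y # w))) \<xi> = translate [x] (prefix_indicator (y # w)) \<xi>"
      unfolding translate_def
      using 3(2) by (intro AE_act_inv[OF measure quasi_inv]) simp_all
    ultimately show ?thesis
      by eventually_elim (simp add: prefix_indicator_Cons False)
  qed
qed

lemma R_bound_real:
  fixes u :: "'a boundary \<Rightarrow> real"
  assumes "(\<lambda>\<zeta>. of_real (u \<zeta>)) \<in> C_boundary" "\<And>\<zeta>. \<bar>u \<zeta>\<bar> \<le> e"
  shows "AE \<xi> in \<mu>. norm (R (\<lambda>\<zeta>. of_real (u \<zeta>)) \<xi>) \<le> e"
proof -
  have "AE \<xi> in \<mu>. R (\<lambda>\<zeta>. of_real e) \<xi> - R (\<lambda>\<zeta>. of_real (u \<zeta>)) \<xi> \<in> \<real>\<^sub>\<ge>\<^sub>0"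
    using assms by (intro R_mono) (auto simp: abs_le_iff)
  moreover have "AE \<xi> in \<mu>. R (\<lambda>\<zeta>. of_real (u \<zeta>)) \<xi> - R (\<lambda>\<zeta>. of_real (- e)) \<xi> \<in> \<real>\<^sub>\<ge>\<^sub>0"
    using assms by (intro R_mono) (auto simp: abs_le_iff minus_le_iff)
  ultimately show ?thesis
    using R_const[of "of_real e"] R_const[of "of_real (- e)"]
    by eventually_elim (auto simp: complex_nonneg_Reals_iff cmod_eq_Re)
qed

text \<open>
  The constant \<open>2\<close> comes from treating real and imaginary parts separately; any constant serves for the
  density argument below.
\<close>

lemma R_bound:
  assumes f: "f \<in> C_boundary" and bound: "\<And>\<zeta>. norm (f \<zeta>) \<le> e"
  shows "AE \<xi> in \<mu>. norm (R f \<xi>) \<le> 2 * e"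
proof -
  have Re_C: "(\<lambda>\<zeta>. complex_of_real (Re (f \<zeta>))) \<in> C_boundary"
    and Im_C: "(\<lambda>\<zeta>. complex_of_real (Im (f \<zeta>))) \<in> C_boundary"
    using f by (auto simp: C_boundary_def intro!: continuous_intros)
  have f_eq: "(\<lambda>\<zeta>. complex_of_real (Re (f \<zeta>)) + \<i> * complex_of_real (Im (f \<zeta>))) = f"
    by (simp add: fun_eq_iff complex_eq[symmetric])
  have "AE \<xi> in \<mu>. norm (R (\<lambda>\<zeta>. of_real (Re (f \<zeta>))) \<xi>) \<le> e"
    by (rule R_bound_real[OF Re_C order_trans[OF abs_Re_le_cmod bound]])
  moreover have "AE \<xi> in \<mu>. norm (R (\<lambda>\<zeta>. of_real (Im (f \<zeta>))) \<xi>) \<le> e"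
    by (rule R_bound_real[OF Im_C order_trans[OF abs_Im_le_cmod bound]])
  ultimately show ?thesis
    using R_add[OF Re_C C_boundary_scale[OF Im_C, of \<i>]] R_scale[OF Im_C, of \<i>]
  proof eventually_elim
    case (elim \<xi>)
    then have "R f \<xi> = R (\<lambda>\<zeta>. of_real (Re (f \<zeta>))) \<xi> + \<i> * R (\<lambda>\<zeta>. of_real (Im (f \<zeta>))) \<xi>"
      by (simp add: f_eq)
    then have "norm (R f \<xi>) \<le> norm (R (\<lambda>\<zeta>. of_real (Re (f \<zeta>))) \<xi>) + norm (\<i> * R (\<lambda>\<zeta>. of_real (Im (f \<zeta>))) \<xi>)"
      by (simp only: norm_triangle_ineq)
    then show ?case using elim(1,2) by (simp add: norm_mult)
  qed
qed

text \<open>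
  By uniform continuity \<open>f\<close> is within \<open>e\<close> of a combination \<open>g\<close> of cylinder indicators, which \<open>R\<close> fixes.
\<close>

lemma R_eq:
  assumes f: "f \<in> C_boundary"
  shows "AE \<xi> in \<mu>. R f \<xi> = f \<xi>"
proof -
  have "AE \<xi> in \<mu>. norm (R f \<xi> - f \<xi>) \<le> 3 * inverse (real (Suc k))" for k
  proof -
    define e where "e = inverse (real (Suc k))"
    have "e > 0" by (simp add: e_def)
    then obtain n where n: "\<And>\<xi> \<zeta>. boundary_prefix n \<xi> = boundary_prefix n \<zeta> \<Longrightarrow> dist (f \<xi>) (f \<zeta>) < e"
      using continuous_uniform_on_prefixes[of f e] f by (auto simp: C_boundary_def)
    define W where "W = range (boundary_prefix n :: 'a boundary \<Rightarrow> _)"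
    have "finite W"
      by (rule finite_subset[OF _ finite_lists_length_eq[OF finite[of UNIV], of n]])
        (auto simp: W_def boundary_prefix_def)
    have length_W: "length w = n" if "w \<in> W" for w
      using that by (auto simp: W_def boundary_prefix_def)
    define c where "c w = f (SOME \<xi>. boundary_prefix n \<xi> = w)" for w
    define g where "g \<zeta> = (\<Sum>w\<in>W. c w * prefix_indicator w \<zeta>)" for \<zeta>
    have g_eq: "g \<zeta> = c (boundary_prefix n \<zeta>)" for \<zeta>
    proof -
      have "g \<zeta> = (\<Sum>w\<in>W. if w = boundary_prefix n \<zeta> then c w else 0)"
        unfolding g_def by (intro sum.cong refl) (auto simp: prefix_indicator_def length_W)
      then show ?thesis using \<open>finite W\<close> by (simp add: W_def)
    qed
    have close: "norm (f \<zeta> - g \<zeta>) \<le> e" for \<zeta>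
    proof -
      have "boundary_prefix n (SOME \<xi>. boundary_prefix n \<xi> = boundary_prefix n \<zeta>) = boundary_prefix n \<zeta>"
        by (rule someI[of _ \<zeta>]) simp
      then show ?thesis using n[of \<zeta>] by (simp add: g_eq c_def dist_norm less_imp_le)
    qed
    have term_C: "(\<lambda>\<zeta>. c w * prefix_indicator w \<zeta>) \<in> C_boundary" for w
      by (intro C_boundary_scale C_boundary_prefix_indicator)
    then have g: "g \<in> C_boundary" unfolding g_def[abs_def] by (intro C_boundary_sum)
    have "AE \<xi> in \<mu>. R g \<xi> = (\<Sum>w\<in>W. R (\<lambda>\<zeta>. c w * prefix_indicator w \<zeta>) \<xi>)"
      unfolding g_def[abs_def] using \<open>finite W\<close> term_C by (intro R_sum)
    moreover have "AE \<xi> in \<mu>. \<forall>w\<in>W. R (\<lambda>\<zeta>. c w * prefix_indicator w \<zeta>) \<xi> = c w * R (prefix_indicator w) \<xi>"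
      using \<open>finite W\<close> by (intro AE_finite_allI R_scale C_boundary_prefix_indicator)
    moreover have "AE \<xi> in \<mu>. \<forall>w\<in>W. R (prefix_indicator w) \<xi> = prefix_indicator w \<xi>"
      using \<open>finite W\<close> by (intro AE_finite_allI R_prefix_indicator_eq)
    ultimately have R_g: "AE \<xi> in \<mu>. R g \<xi> = g \<xi>"
      by eventually_elim (simp add: g_def)
    have "AE \<xi> in \<mu>. norm (R (\<lambda>\<zeta>. f \<zeta> + (-1) * g \<zeta>) \<xi>) \<le> 2 * e"
      using close by (intro R_bound C_boundary_add C_boundary_scale f g) simp
    with R_add[OF f C_boundary_scale[OF g, of "-1"]] R_scale[OF g, of "-1"] R_g
    show ?thesis
    proof eventually_elim
      case (elim \<xi>)
      then have "norm (R f \<xi> - g \<xi>) \<le> 2 * e" by simp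
      moreover have "norm (g \<xi> - f \<xi>) \<le> e" using close[of \<xi>] by (simp add: norm_minus_commute)
      ultimately show ?case
        using norm_triangle_le[of "R f \<xi> - g \<xi>" "g \<xi> - f \<xi>" "3 * e"] by (simp add: e_def)
    qed
  qed
  then have "AE \<xi> in \<mu>. \<forall>k. norm (R f \<xi> - f \<xi>) \<le> 3 * inverse (real (Suc k))"
    by (simp add: AE_all_countable)
  then show ?thesis
  proof eventually_elim
    case (elim \<xi>)
    show ?case
    proof (rule ccontr)
      assume "R f \<xi> \<noteq> f \<xi>"
      then have "0 < norm (R f \<xi> - f \<xi>) / 3" by simp
      then obtain k where "inverse (real (Suc k)) < norm (R f \<xi> - f \<xi>) / 3"
        using reals_Archimedean by blast
      then show False using elim[rule_format, of k] by simp
    qed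
  qed
qed

end

theorem proposition3:
  fixes \<mu> :: "('a::finite) boundary measure"
    and \<phi> :: "('a boundary \<Rightarrow> complex) \<Rightarrow> ('a boundary \<Rightarrow> complex) set"
  assumes "2 \<le> CARD('a)"
    and "boundary_measure \<mu>" and "quasi_invariant \<mu>" and "doubly_ergodic \<mu>"
    and "\<phi> \<in> C_boundary \<rightarrow> Linf \<mu>"
    and "linear_map \<mu> \<phi>" and "unital_map \<mu> \<phi>" and "positive_map \<mu> \<phi>" and "equivariant_map \<mu> \<phi>"
  shows "\<forall>f\<in>C_boundary. \<phi> f = Linf_class \<mu> f"
proof -
  have "\<exists>g. g \<in> Linf_fun \<mu> \<and> \<phi> f = Linf_class \<mu> g" if "f \<in> C_boundary" for f
    using funcset_mem[OF assms(5) that] by (auto simp: Linf_def Linf_class_def elim!: quotientE)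
  then obtain R where R: "\<And>f. f \<in> C_boundary \<Longrightarrow> R f \<in> Linf_fun \<mu>"
    "\<And>f. f \<in> C_boundary \<Longrightarrow> \<phi> f = Linf_class \<mu> (R f)" by metis
  have R_eqI: "AE \<xi> in \<mu>. R f \<xi> = h \<xi>"
    if "f \<in> C_boundary" "h \<in> Linf_fun \<mu>" "\<phi> f = Linf_class \<mu> h" for f h
    using that R(2)[OF that(1)] Linf_class_eq_iff[OF R(1)[OF that(1)] that(2)] by simp
  have const: "(\<lambda>_. c) \<in> Linf_fun \<mu>" for c :: complex
    by (auto simp: Linf_fun_def)
  interpret equivariant_operator \<mu> R
  proof
    fix f g :: "'a boundary \<Rightarrow> complex" and c and s :: "'a letter list"
    assume f: "f \<in> C_boundary"
    show "R f \<in> borel_measurable \<mu>" using R(1)[OF f] by (simp add: Linf_fun_def)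
    show "AE \<xi> in \<mu>. R (\<lambda>\<zeta>. f \<zeta> + g \<zeta>) \<xi> = R f \<xi> + R g \<xi>" if g: "g \<in> C_boundary"
      using assms(6) f g R
      by (intro R_eqI C_boundary_add Linf_fun_add) (simp_all add: linear_map_def Linf_add_class)
    show "AE \<xi> in \<mu>. R (\<lambda>\<zeta>. c * f \<zeta>) \<xi> = c * R f \<xi>"
      using assms(6) f R
      by (intro R_eqI C_boundary_scale Linf_fun_scale) (simp_all add: linear_map_def Linf_scale_class)
    show "AE \<xi> in \<mu>. R f \<xi> \<in> \<real>\<^sub>\<ge>\<^sub>0" if "\<And>\<zeta>. f \<zeta> \<in> \<real>\<^sub>\<ge>\<^sub>0"
    proof -
      have "Linf_nonneg \<mu> (\<phi> f)" using assms(8) f that by (simp add: positive_map_def)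
      then show ?thesis using R(2)[OF f] Linf_nonneg_class[OF R(1)[OF f]] by simp
    qed
    show "AE \<xi> in \<mu>. R (translate s f) \<xi> = translate s (R f) \<xi>" if s: "s \<in> carrier free_group"
    proof (intro R_eqI Linf_fun_translate assms s R f)
      show "translate s f \<in> C_boundary" using C_boundary_act[OF f] by (simp add: translate_def)
      show "\<phi> (translate s f) = Linf_class \<mu> (translate s (R f))"
        using assms(9) s f R[OF f] Linf_translate_class[OF assms(2,3) s] by (simp add: equivariant_map_def)
    qed
  next
    show "AE \<xi> in \<mu>. R (\<lambda>_. 1) \<xi> = 1"
      using assms(7) const by (intro R_eqI) (simp_all add: unital_map_def)
  qed (use assms in auto)
  show ?thesis
  proof
    fix f :: "'a boundary \<Rightarrow> complex" assume f: "f \<in> C_boundary"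
    have "f \<in> Linf_fun \<mu>"
    proof -
      have "compact (range f)"
        using f compact_continuous_image[OF _ compact_boundary] by (simp add: C_boundary_def)
      then obtain C where "\<And>\<xi>. norm (f \<xi>) \<le> C"
        using compact_imp_bounded[of "range f"] by (auto simp: bounded_iff)
      moreover have "f \<in> borel_measurable \<mu>"
        using f borel_measurable_continuous_onI[of f]
        by (simp add: C_boundary_def measurable_cong_sets[OF sets_\<mu> refl])
      ultimately show ?thesis by (auto simp: Linf_fun_def)
    qed
    then show "\<phi> f = Linf_class \<mu> f"
      using R(2)[OF f] R_eq[OF f] Linf_class_eq_iff[OF R(1)[OF f]] by simp
  qed
qed

end
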